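(* Let $n$ be a positive integer and $r\geqslant 3$ with $2n-1<r$. Among planar $C^r$ systems of the form $\dot x=y+P(x,y)$, $\dot y=Q(x,y)$, with $j^1P(0)=j^1Q(0)=0$, having an isolated monodromic nilpotent singular point at the origin with Andreev number $n$, the monodromy conditions (i) and (ii) (see context) are invariant by local diffeomorphisms. That is, if $X$ and $Y$ are the vector fields of two such systems and there is a local $C^r$ diffeomorphism $\varphi$ at the origin, $\varphi(0)=0$, with $d\varphi\cdot Y=X\circ\varphi$, then $X$ satisfies (i) if and only if $Y$ satisfies (i), and $X$ satisfies (ii) if and only if $Y$ satisfies (ii).
   Context: $j^lG(0)$ denotes the $l$-jet of $G$ at $0$. For such a system let $y=F(x)$ be the solution of $y+P(x,y)=0$ through the origin, $f(x)=Q(x,F(x))$, and $\Phi(x)=\left(\partial_xP+\partial_yQ\right)(x,F(x))$. Write $f(x)=ax^{\alpha}+O(x^{\alpha+1})$ with $a\ne0$ and $\Phi(x)=bx^\beta+O(x^{\beta+1})$ with $b\neq 0$ (if $\Phi$ has nonzero jet). The origin is monodromic (orbits turn around it, a first return map is defined) if and only if $a<0$, $\alpha=2n-1$ and one of the following holds: (i) $\beta>n-1$ or the jet $j^{r-1}\Phi(0)$ vanishes; (ii) $\beta=n-1$ and $b^2+4an<0$. The integer $n$ is called the Andreev number. *)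

theory Defs
  imports "HOL-Analysis.Analysis" "HOL-Library.Landau_Symbols"
begin

text \<open>
  On an open set \<open>S\<close> of a Euclidean space, \<open>higher_differentiable_on S f k\<close> says that \<open>f\<close> is of
  class \<open>C\<^sup>k\<close>: all iterated directional derivatives up to order \<open>k\<close> exist and are continuous.
\<close>

primrec higher_differentiable_on ::
    "'a::euclidean_space set \<Rightarrow> ('a \<Rightarrow> 'b::real_normed_vector) \<Rightarrow> nat \<Rightarrow> bool" where
  "higher_differentiable_on S f 0 \<longleftrightarrow> continuous_on S f"
| "higher_differentiable_on S f (Suc k) \<longleftrightarrow>
     (\<forall>x\<in>S. f differentiable at x) \<and>
     (\<forall>v. higher_differentiable_on S (\<lambda>x. frechet_derivative f (at x) v) k)"

definition C_near_0 :: "nat \<Rightarrow> ('a::euclidean_space \<Rightarrow> 'b::real_normed_vector) \<Rightarrow> bool" where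
  "C_near_0 k f \<longleftrightarrow> (\<exists>U. open U \<and> 0 \<in> U \<and> higher_differentiable_on U f k)"

definition vf :: "(real \<times> real \<Rightarrow> real) \<Rightarrow> (real \<times> real \<Rightarrow> real) \<Rightarrow> real \<times> real \<Rightarrow> real \<times> real" where
  "vf P Q p = (snd p + P p, Q p)"

definition zero_1_jet :: "(real \<times> real \<Rightarrow> real) \<Rightarrow> bool" where
  "zero_1_jet P \<longleftrightarrow> P 0 = 0 \<and> (P has_derivative (\<lambda>_. 0)) (at 0)"

definition nilpotent_system ::
    "nat \<Rightarrow> (real \<times> real \<Rightarrow> real) \<Rightarrow> (real \<times> real \<Rightarrow> real) \<Rightarrow> bool" where
  "nilpotent_system r P Q \<longleftrightarrow>
     C_near_0 r P \<and> C_near_0 r Q \<and> zero_1_jet P \<and> zero_1_jet Q"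

definition isolated_singular_point :: "(real \<times> real \<Rightarrow> real \<times> real) \<Rightarrow> bool" where
  "isolated_singular_point X \<longleftrightarrow> X 0 = 0 \<and> (\<forall>\<^sub>F p in at 0. X p \<noteq> 0)"

text \<open>
  \<open>first_turn X v c \<epsilon> p\<close>: the forward orbit of \<open>p\<close> makes exactly one turn around the origin, inside
  the ball of radius \<open>\<epsilon>\<close>, before hitting the half-open segment \<open>{s v | 0 < s < c}\<close> again.
  The function \<open>\<theta>\<close> is a continuous choice of the polar angle along the orbit.
\<close>

definition first_turn ::
    "(real \<times> real \<Rightarrow> real \<times> real) \<Rightarrow> real \<times> real \<Rightarrow> real \<Rightarrow> real \<Rightarrow> real \<times> real \<Rightarrow> bool" where
  "first_turn X v c \<epsilon> p \<longleftrightarrow>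
     (\<exists>T>0. \<exists>\<gamma> \<theta>.
        \<gamma> 0 = p \<and>
        (\<forall>t\<in>{0..T}. (\<gamma> has_vector_derivative X (\<gamma> t)) (at t within {0..T})) \<and>
        (\<forall>t\<in>{0..T}. \<gamma> t \<noteq> 0 \<and> norm (\<gamma> t) < \<epsilon>) \<and>
        \<gamma> T \<in> (\<lambda>s. s *\<^sub>R v) ` {0<..<c} \<and>
        (\<forall>t\<in>{0<..<T}. \<gamma> t \<notin> (\<lambda>s. s *\<^sub>R v) ` {0<..<c}) \<and>
        continuous_on {0..T} \<theta> \<and>
        (\<forall>t\<in>{0..T}. \<gamma> t = norm (\<gamma> t) *\<^sub>R (cos (\<theta> t), sin (\<theta> t))) \<and>
        \<bar>\<theta> T - \<theta> 0\<bar> = 2 * pi)"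

text \<open>
  The origin is monodromic if orbits turn around it and a first return map is defined on a section
  with endpoint at the origin. A straight section is no restriction for \<open>x' = y + P, y' = Q\<close> with
  vanishing \<open>1\<close>-jets of \<open>P\<close> and \<open>Q\<close>, since \<open>{(0, y) | 0 < y < c}\<close> is transversal for small \<open>c\<close>.
  The requirement that the turn takes place in arbitrarily small balls makes the notion local; it
  excludes, for instance, a saddle surrounded by a pair of homoclinic loops.
\<close>

definition monodromic :: "(real \<times> real \<Rightarrow> real \<times> real) \<Rightarrow> bool" where
  "monodromic X \<longleftrightarrow>
     (\<exists>v c. v \<noteq> 0 \<and> c > 0 \<and>
        (\<forall>s\<in>{0<..<c}. fst v * snd (X (s *\<^sub>R v)) - snd v * fst (X (s *\<^sub>R v)) \<noteq> 0) \<and>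
        (\<forall>\<epsilon>>0. \<exists>\<delta>\<in>{0<..c}. \<forall>s\<in>{0<..<\<delta>}. first_turn X v c \<epsilon> (s *\<^sub>R v)))"

text \<open>
  \<open>F\<close> is the solution of \<open>y + P (x, y) = 0\<close> through the origin; for \<open>P\<close> of class \<open>C\<^sup>r\<close>, \<open>r \<ge> 1\<close>, with
  vanishing \<open>1\<close>-jet it exists and its germ is unique by the implicit function theorem.
\<close>

definition implicit_solution :: "nat \<Rightarrow> (real \<times> real \<Rightarrow> real) \<Rightarrow> (real \<Rightarrow> real) \<Rightarrow> bool" where
  "implicit_solution r P F \<longleftrightarrow>
     F 0 = 0 \<and> C_near_0 r F \<and> (\<forall>\<^sub>F x in nhds 0. F x + P (x, F x) = 0)"

definition f_of :: "(real \<times> real \<Rightarrow> real) \<Rightarrow> (real \<Rightarrow> real) \<Rightarrow> real \<Rightarrow> real" where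
  "f_of Q F x = Q (x, F x)"

definition Phi_of ::
    "(real \<times> real \<Rightarrow> real) \<Rightarrow> (real \<times> real \<Rightarrow> real) \<Rightarrow> (real \<Rightarrow> real) \<Rightarrow> real \<Rightarrow> real" where
  "Phi_of P Q F x = deriv (\<lambda>s. P (s, F x)) x + deriv (\<lambda>t. Q (x, t)) (F x)"

text \<open>
  \<open>leading_term h c k\<close>: \<open>h x = c x\<^sup>k + \<dots>\<close> with \<open>c \<noteq> 0\<close>. The remainder is \<open>o(x\<^sup>k)\<close>, which for \<open>h\<close> of
  class \<open>C\<^bsup>k+1\<^esup>\<close> is the same as \<open>O(x\<^bsup>k+1\<^esup>)\<close>. If \<open>h\<close> is only \<open>C\<^sup>k\<close> and \<open>c x\<^sup>k\<close> is its \<open>k\<close>-jet (as can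
  happen for \<open>\<Phi>\<close>, of class \<open>C\<^bsup>r-1\<^esup>\<close>, with \<open>k = r - 1\<close>), Taylor's theorem only provides \<open>o(x\<^sup>k)\<close>.
\<close>

definition leading_term :: "(real \<Rightarrow> real) \<Rightarrow> real \<Rightarrow> nat \<Rightarrow> bool" where
  "leading_term h c k \<longleftrightarrow> c \<noteq> 0 \<and> (\<lambda>x. h x - c * x ^ k) \<in> o[at 0](\<lambda>x. x ^ k)"

definition zero_jet :: "nat \<Rightarrow> (real \<Rightarrow> real) \<Rightarrow> bool" where
  "zero_jet m h \<longleftrightarrow> (\<forall>k\<le>m. (deriv ^^ k) h 0 = 0)"

definition andreev_number :: "nat \<Rightarrow> (real \<Rightarrow> real) \<Rightarrow> bool" where
  "andreev_number n f \<longleftrightarrow> n \<ge> 1 \<and> (\<exists>a. leading_term f a (2 * n - 1))"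

definition condition_i :: "nat \<Rightarrow> nat \<Rightarrow> (real \<Rightarrow> real) \<Rightarrow> bool" where
  "condition_i r n \<Phi> \<longleftrightarrow> (\<exists>b \<beta>. leading_term \<Phi> b \<beta> \<and> \<beta> > n - 1) \<or> zero_jet (r - 1) \<Phi>"

definition condition_ii :: "nat \<Rightarrow> (real \<Rightarrow> real) \<Rightarrow> (real \<Rightarrow> real) \<Rightarrow> bool" where
  "condition_ii n f \<Phi> \<longleftrightarrow>
     (\<exists>a b \<beta>. leading_term f a (2 * n - 1) \<and> leading_term \<Phi> b \<beta> \<and>
        \<beta> = n - 1 \<and> b\<^sup>2 + 4 * a * real n < 0)"

definition local_diffeo :: "nat \<Rightarrow> (real \<times> real \<Rightarrow> real \<times> real) \<Rightarrow> bool" where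
  "local_diffeo r \<phi> \<longleftrightarrow>
     \<phi> 0 = 0 \<and>
     (\<exists>U V \<psi>. open U \<and> open V \<and> 0 \<in> U \<and> homeomorphism U V \<phi> \<psi> \<and>
        higher_differentiable_on U \<phi> r \<and> higher_differentiable_on V \<psi> r)"

text \<open>\<open>d\<phi> \<cdot> Y = X \<circ> \<phi>\<close> near the origin.\<close>

definition conjugates ::
    "(real \<times> real \<Rightarrow> real \<times> real) \<Rightarrow> (real \<times> real \<Rightarrow> real \<times> real) \<Rightarrow>
     (real \<times> real \<Rightarrow> real \<times> real) \<Rightarrow> bool" where
  "conjugates \<phi> Y X \<longleftrightarrow> (\<forall>\<^sub>F p in nhds 0. frechet_derivative \<phi> (at p) (Y p) = X (\<phi> p))"

end

theory Submission
  imports Defs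
begin

text \<open>
  Taking the trace in the derivative of \<open>d\<phi> \<cdot> Y = X \<circ> \<phi>\<close> shows that \<open>div X \<circ> \<phi> - div Y\<close> is linear
  in \<open>Y\<close>. On the curve \<open>y = F\<^sub>Y x\<close> the field is \<open>Y = (0, f\<^sub>Y)\<close> and \<open>div Y = \<Phi>\<^sub>Y\<close>, while \<open>\<phi>\<close> maps this
  curve to within \<open>O(f\<^sub>Y)\<close> of \<open>y = F\<^sub>X x\<close>, where \<open>div X = \<Phi>\<^sub>X\<close>. Hence \<open>\<Phi>\<^sub>Y(x) = \<Phi>\<^sub>X(u(x)) + O(x\<^bsup>2n-1\<^esup>)\<close>
  with \<open>u(x) \<sim> \<alpha> x\<close>, \<open>\<alpha> \<noteq> 0\<close>, and the second component of the conjugacy gives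
  \<open>f\<^sub>X(u(x)) \<sim> \<alpha> f\<^sub>Y(x)\<close>. Therefore \<open>\<Phi>\<^sub>X\<close> and \<open>\<Phi>\<^sub>Y\<close> have the same order up to \<open>n - 1\<close>, their coefficients
  satisfy \<open>b\<^sub>Y = \<alpha>\<^bsup>n-1\<^esup> b\<^sub>X\<close> and \<open>a\<^sub>Y = \<alpha>\<^bsup>2n-2\<^esup> a\<^sub>X\<close>, and \<open>b\<^sup>2 + 4an\<close> is multiplied by \<open>\<alpha>\<^bsup>2n-2\<^esup> > 0\<close>.
\<close>

section \<open>Functions of class \<open>C\<^sup>k\<close>\<close>

lemma higher_differentiable_on_cong:
  assumes "open U" "\<And>x. x \<in> U \<Longrightarrow> f x = g x" "higher_differentiable_on U f k"
  shows "higher_differentiable_on U g k"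
  using assms(2,3)
proof (induction k arbitrary: f g)
  case 0
  then show ?case by (simp cong: continuous_on_cong)
next
  case (Suc k)
  have g: "(g has_derivative frechet_derivative f (at x)) (at x)" if "x \<in> U" for x
    using Suc.prems that \<open>open U\<close>
    by (auto intro: has_derivative_transform_within_open simp: frechet_derivative_works)
  have "higher_differentiable_on U (\<lambda>x. frechet_derivative g (at x) v) k" for v
  proof (rule Suc.IH)
    show "frechet_derivative f (at x) v = frechet_derivative g (at x) v" if "x \<in> U" for x
      by (simp flip: frechet_derivative_at[OF g[OF that]])
    show "higher_differentiable_on U (\<lambda>x. frechet_derivative f (at x) v) k"
      using Suc.prems(2) by simp
  qed
  moreover have "\<forall>x\<in>U. g differentiable at x"
    using g differentiableI by blast
  ultimately show ?case by simp
qed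

text \<open>By uniqueness of derivatives, an explicit formula may replace
  \<open>frechet_derivative\<close>. The rules for addition, products, linear images and
  compositions begin their induction step here.\<close>

lemma higher_differentiable_on_SucI:
  assumes "open U" "\<And>x. x \<in> U \<Longrightarrow> (f has_derivative f' x) (at x)"
    and "\<And>v. higher_differentiable_on U (\<lambda>x. f' x v) k"
  shows "higher_differentiable_on U f (Suc k)"
proof -
  have "f' x = frechet_derivative f (at x)" if "x \<in> U" for x
    using assms(2)[OF that] by (rule frechet_derivative_at)
  then have "higher_differentiable_on U (\<lambda>x. frechet_derivative f (at x) v) k" for v
    by (intro higher_differentiable_on_cong[OF assms(1) _ assms(3)[of v]]) simp
  moreover have "\<forall>x\<in>U. f differentiable at x"
    using assms(2) differentiableI by blast
  ultimately show ?thesis by simp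
qed

lemma higher_differentiable_on_SucD:
  assumes "higher_differentiable_on U f (Suc k)" "x \<in> U"
  shows "(f has_derivative frechet_derivative f (at x)) (at x)"
  using assms by (simp add: frechet_derivative_works)

lemma higher_differentiable_on_subset:
  "higher_differentiable_on U f k \<Longrightarrow> V \<subseteq> U \<Longrightarrow> higher_differentiable_on V f k"
  by (induction k arbitrary: f) (auto intro: continuous_on_subset)

lemma higher_differentiable_on_Suc_imp:
  "higher_differentiable_on U f (Suc k) \<Longrightarrow> higher_differentiable_on U f k"
proof (induction k arbitrary: f)
  case 0
  then show ?case
    by (auto intro!: continuous_at_imp_continuous_on differentiable_imp_continuous_within)
next
  case (Suc k)
  then show ?case
    unfolding higher_differentiable_on.simps(2)[of U f] by blast
qed

lemma higher_differentiable_on_le: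
  assumes "higher_differentiable_on U f m" "k \<le> m"
  shows "higher_differentiable_on U f k"
  using assms(2,1) by (induction rule: inc_induct)
    (blast intro: higher_differentiable_on_Suc_imp)+

section \<open>Closure of the class C^k under algebraic operations and composition\<close>

lemma higher_differentiable_on_const: "higher_differentiable_on U (\<lambda>x. c) k"
  by (induction k arbitrary: c) simp_all

lemma higher_differentiable_on_add:
  assumes "open U" "higher_differentiable_on U f k" "higher_differentiable_on U g k"
  shows "higher_differentiable_on U (\<lambda>x. f x + g x) k"
  using assms(2,3)
proof (induction k arbitrary: f g)
  case 0
  then show ?case by (auto intro: continuous_on_add)
next
  case (Suc k)
  show ?case
  proof (rule higher_differentiable_on_SucI[OF \<open>open U\<close>])
    fix x assume "x \<in> U"
    then show "((\<lambda>x. f x + g x) has_derivative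
        (\<lambda>v. frechet_derivative f (at x) v + frechet_derivative g (at x) v)) (at x)"
      using Suc.prems by (intro has_derivative_add higher_differentiable_on_SucD)
  qed (use Suc in auto)
qed

lemma higher_differentiable_on_sum:
  assumes "open U" "\<And>i. i \<in> I \<Longrightarrow> higher_differentiable_on U (f i) k"
  shows "higher_differentiable_on U (\<lambda>x. \<Sum>i\<in>I. f i x) k"
  using assms(2) by (induction I rule: infinite_finite_induct)
    (auto intro: higher_differentiable_on_const higher_differentiable_on_add[OF \<open>open U\<close>])

lemma higher_differentiable_on_scaleR:
  assumes "open U" "higher_differentiable_on U f k" "higher_differentiable_on U g k"
  shows "higher_differentiable_on U (\<lambda>x. f x *\<^sub>R g x) k"
  using assms(2,3)
proof (induction k arbitrary: f g)
  case 0
  then show ?case by (auto intro: continuous_on_scaleR)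
next
  case (Suc k)
  show ?case
  proof (rule higher_differentiable_on_SucI[OF \<open>open U\<close>])
    fix x assume "x \<in> U"
    then show "((\<lambda>x. f x *\<^sub>R g x) has_derivative
        (\<lambda>v. f x *\<^sub>R frechet_derivative g (at x) v + frechet_derivative f (at x) v *\<^sub>R g x)) (at x)"
      using Suc.prems by (intro has_derivative_scaleR higher_differentiable_on_SucD)
  next
    fix v
    have "higher_differentiable_on U (\<lambda>x. frechet_derivative f (at x) v) k"
      "higher_differentiable_on U (\<lambda>x. frechet_derivative g (at x) v) k"
      using Suc.prems by simp_all
    \<comment> \<open>Each term of the product rule pairs a derivative of class C^k with an
      undifferentiated factor; the latter is lowered to class C^k so that the induction hypothesis
      covers the product.\<close>
    then show "higher_differentiable_on U
        (\<lambda>x. f x *\<^sub>R frechet_derivative g (at x) v + frechet_derivative f (at x) v *\<^sub>R g x) k"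
      using Suc.prems[THEN higher_differentiable_on_Suc_imp]
      by (intro higher_differentiable_on_add[OF \<open>open U\<close>] Suc.IH)
  qed
qed

lemma higher_differentiable_on_bounded_linear:
  assumes "open U" "bounded_linear L" "higher_differentiable_on U f k"
  shows "higher_differentiable_on U (\<lambda>x. L (f x)) k"
  using assms(3)
proof (induction k arbitrary: f)
  case 0
  then show ?case using assms(2) by (auto intro: bounded_linear.continuous_on)
next
  case (Suc k)
  show ?case
  proof (rule higher_differentiable_on_SucI[OF \<open>open U\<close>])
    fix x assume "x \<in> U"
    then show "((\<lambda>x. L (f x)) has_derivative (\<lambda>v. L (frechet_derivative f (at x) v))) (at x)"
      using Suc.prems by (intro bounded_linear.has_derivative[OF assms(2)] higher_differentiable_on_SucD)
  qed (use Suc in auto)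
qed

lemma higher_differentiable_on_ident:
  assumes "open U"
  shows "higher_differentiable_on U (\<lambda>x. x) k"
proof (cases k)
  case (Suc j)
  then show ?thesis
    using higher_differentiable_on_SucI[OF assms has_derivative_ident higher_differentiable_on_const]
    by simp
qed simp

text \<open>By the chain rule, a directional derivative of \<open>f \<circ> g\<close> is
  \<open>\<Sum>\<^sub>b (Dg v \<bullet> b) (Df b \<circ> g)\<close>, to which the induction hypothesis applies.\<close>

lemma higher_differentiable_on_compose:
  fixes f :: "'b::euclidean_space \<Rightarrow> 'c::real_normed_vector" and g :: "'a::euclidean_space \<Rightarrow> 'b"
  assumes "open U" "open V" "g ` V \<subseteq> U"
    and "higher_differentiable_on U f k" "higher_differentiable_on V g k"
  shows "higher_differentiable_on V (\<lambda>x. f (g x)) k"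
  using assms(4,5)
proof (induction k arbitrary: f)
  case 0
  then show ?case using assms(3) by (auto intro: continuous_on_compose2)
next
  case (Suc k)
  show ?case
  proof (rule higher_differentiable_on_SucI[OF \<open>open V\<close>])
    fix x assume "x \<in> V"
    then have f: "(f has_derivative frechet_derivative f (at (g x))) (at (g x))"
      and g: "(g has_derivative frechet_derivative g (at x)) (at x)"
      using Suc.prems assms(3) by (auto intro!: higher_differentiable_on_SucD)
    have lin: "linear (frechet_derivative f (at (g x)))"
      using f has_derivative_linear by blast
    \<comment> \<open>The definition of the class controls derivatives of \<open>f\<close> in fixed
      directions, while the direction \<open>frechet_derivative g (at x) v\<close> moves with
      \<open>x\<close>. The basis expansion makes the directions constant.\<close>
    have "frechet_derivative f (at (g x)) w =
        (\<Sum>b\<in>Basis. (w \<bullet> b) *\<^sub>R frechet_derivative f (at (g x)) b)" for w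
    proof -
      have "frechet_derivative f (at (g x)) w = frechet_derivative f (at (g x)) (\<Sum>b\<in>Basis. (w \<bullet> b) *\<^sub>R b)"
        by (simp add: euclidean_representation)
      then show ?thesis by (simp add: linear_sum[OF lin] linear_scale[OF lin])
    qed
    then show "((\<lambda>x. f (g x)) has_derivative (\<lambda>v. \<Sum>b\<in>Basis.
        (frechet_derivative g (at x) v \<bullet> b) *\<^sub>R frechet_derivative f (at (g x)) b)) (at x)"
      by (intro has_derivative_eq_rhs[OF has_derivative_compose[OF g f]] ext)
  next
    fix v
    have g: "higher_differentiable_on V g k"
      using Suc.prems(2) by (rule higher_differentiable_on_Suc_imp)
    have "higher_differentiable_on V (\<lambda>x. frechet_derivative g (at x) v \<bullet> b) k" for b
      using Suc.prems(2)
      by (intro higher_differentiable_on_bounded_linear[OF \<open>open V\<close> bounded_linear_inner_left]) simp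
    moreover have "higher_differentiable_on V (\<lambda>x. frechet_derivative f (at (g x)) b) k" for b
      using Suc.prems(1) by (intro Suc.IH[OF _ g]) simp
    ultimately show "higher_differentiable_on V (\<lambda>x. \<Sum>b\<in>Basis.
        (frechet_derivative g (at x) v \<bullet> b) *\<^sub>R frechet_derivative f (at (g x)) b) k"
      by (intro higher_differentiable_on_sum[OF \<open>open V\<close>] higher_differentiable_on_scaleR[OF \<open>open V\<close>])
  qed
qed

section \<open>Leading terms\<close>

text \<open>The derivative in direction \<open>1\<close> is the ordinary one. This links the class
  C^k to the iterates of \<open>deriv\<close> that occur in \<open>zero_jet\<close>.\<close>

lemma higher_differentiable_on_deriv:
  fixes h :: "real \<Rightarrow> real"
  assumes "open V" "higher_differentiable_on V h (Suc k)"
  shows "\<And>x. x \<in> V \<Longrightarrow> (h has_real_derivative deriv h x) (at x)"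
    and "higher_differentiable_on V (deriv h) k"
proof -
  show D: "(h has_real_derivative deriv h x) (at x)" if "x \<in> V" for x
    using assms that
    by (metis DERIV_deriv_iff_real_differentiable higher_differentiable_on.simps(2))
  have "frechet_derivative h (at x) 1 = deriv h x" if "x \<in> V" for x
    using fun_cong[OF frechet_derivative_at[OF D[OF that, unfolded has_field_derivative_def]], of 1]
    by simp
  moreover have "higher_differentiable_on V (\<lambda>x. frechet_derivative h (at x) 1) k"
    using assms(2) by simp
  ultimately show "higher_differentiable_on V (deriv h) k"
    by (rule higher_differentiable_on_cong[OF assms(1)])
qed

text \<open>Passing from exponent \<open>k\<close> to \<open>j\<close> inserts the factor
  \<open>x ^ (k - j)\<close>, which tends to 0.\<close>

lemma tendsto_divide_power_less:
  fixes h :: "real \<Rightarrow> real"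
  assumes "((\<lambda>x. h x / x ^ k) \<longlongrightarrow> c) (at 0)" "j < k"
  shows "((\<lambda>x. h x / x ^ j) \<longlongrightarrow> 0) (at 0)"
proof -
  have lim: "((\<lambda>x. h x / x ^ k * x ^ (k - j)) \<longlongrightarrow> c * 0 ^ (k - j)) (at 0)"
    by (rule tendsto_mult[OF assms(1) tendsto_power[OF tendsto_ident_at]])
  have "h x / x ^ k * x ^ (k - j) = h x / x ^ j" if "x \<noteq> 0" for x
  proof -
    have "x ^ k = x ^ j * x ^ (k - j)" using assms(2) by (simp flip: power_add)
    then show ?thesis using that by simp
  qed
  then have "\<forall>\<^sub>F x in at 0. h x / x ^ k * x ^ (k - j) = h x / x ^ j"
    by (simp add: eventually_at_filter)
  with lim have "((\<lambda>x. h x / x ^ j) \<longlongrightarrow> c * 0 ^ (k - j)) (at 0)"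
    by (rule Lim_transform_eventually)
  then show ?thesis
    using assms(2) by (simp add: power_0_left)
qed

lemma eventually_power_nonzero: "\<forall>\<^sub>F x::real in at 0. x ^ k \<noteq> 0"
  using eventually_neq_at_within[of 0 0 UNIV] by eventually_elim simp

text \<open>Division by \<open>x ^ k\<close> turns the little-o condition into a limit, so that
  orders and coefficients can be compared by uniqueness of limits.\<close>

lemma leading_term_iff:
  "leading_term h c k \<longleftrightarrow> c \<noteq> 0 \<and> ((\<lambda>x. h x / x ^ k) \<longlongrightarrow> c) (at 0)"
proof -
  have "(\<lambda>x. h x - c * x ^ k) \<in> o[at 0](\<lambda>x. x ^ k) \<longleftrightarrow>
      ((\<lambda>x. (h x - c * x ^ k) / x ^ k) \<longlongrightarrow> 0) (at 0)"
    by (rule iffI, erule smalloD_tendsto, erule smalloI_tendsto[OF _ eventually_power_nonzero])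
  also have "\<dots> \<longleftrightarrow> ((\<lambda>x. h x / x ^ k - c) \<longlongrightarrow> 0) (at 0)"
    using eventually_power_nonzero[of k]
    by (intro tendsto_cong, eventually_elim) (simp add: diff_divide_distrib)
  finally show ?thesis
    unfolding leading_term_def by (simp add: LIM_zero_iff)
qed

text \<open>Taylor's theorem with Peano remainder, by repeated use of l'Hopital's rule: each
  differentiation contributes a factor \<open>1 + real k\<close> to the factorial. The derivative of
  order \<open>k\<close> may itself be 0, which covers vanishing jets.\<close>

lemma taylor_first_nonzero:
  fixes h :: "real \<Rightarrow> real"
  assumes "open V" "0 \<in> V" "higher_differentiable_on V h k" "\<And>j. j < k \<Longrightarrow> (deriv ^^ j) h 0 = 0"
  shows "((\<lambda>x. h x / x ^ k) \<longlongrightarrow> (deriv ^^ k) h 0 / fact k) (at 0)"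
  using assms(3,4)
proof (induction k arbitrary: h)
  case 0
  then show ?case using assms(1,2) by (auto simp: continuous_on_eq_continuous_at isCont_def)
next
  case (Suc k)
  note h = higher_differentiable_on_deriv[OF \<open>open V\<close> Suc.prems(1)]
  have V: "\<forall>\<^sub>F x in at 0. x \<in> V"
    using assms(1,2) by (auto simp: eventually_at_filter eventually_nhds)
  have h': "((\<lambda>x. deriv h x / x ^ k) \<longlongrightarrow> (deriv ^^ k) (deriv h) 0 / fact k) (at 0)"
    using Suc.IH[OF h(2)] Suc.prems(2) by (metis Suc_mono comp_apply funpow_Suc_right)
  have "((\<lambda>x. deriv h x / x ^ k / (1 + real k)) \<longlongrightarrow> (deriv ^^ k) (deriv h) 0 / fact k / (1 + real k)) (at 0)"
    by (rule tendsto_divide[OF h' tendsto_const]) simp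
  then have lim: "((\<lambda>x. deriv h x / ((1 + real k) * x ^ k)) \<longlongrightarrow>
      (deriv ^^ Suc k) h 0 / fact (Suc k)) (at 0)"
    by (simp add: funpow_Suc_right field_simps del: funpow.simps)
  show ?case
  proof (rule lhopital[OF _ _ eventually_power_nonzero _ _ _ lim])
    show "(h \<longlongrightarrow> 0) (at 0)"
      using DERIV_isCont[OF h(1)[OF assms(2)]] Suc.prems(2)[of 0] by (simp add: isCont_def)
    show "((\<lambda>x::real. x ^ Suc k) \<longlongrightarrow> 0) (at 0)"
      using tendsto_power[OF tendsto_ident_at[of "0::real" UNIV], of "Suc k"] by simp
    show "\<forall>\<^sub>F x in at 0. (h has_real_derivative deriv h x) (at x)"
      using V h(1) by (rule eventually_mono)
    show "\<forall>\<^sub>F x::real in at 0. (1 + real k) * x ^ k \<noteq> 0"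
      using eventually_power_nonzero[of k] by eventually_elim simp
    show "\<forall>\<^sub>F x in at 0. ((\<lambda>x. x ^ Suc k) has_real_derivative (1 + real k) * x ^ k) (at x)"
    proof (rule always_eventually, rule allI)
      show "((\<lambda>x. x ^ Suc k) has_real_derivative (1 + real k) * x ^ k) (at x)" for x
        using DERIV_pow[of "Suc k" x] by simp
    qed
  qed
qed

text \<open>The first nonvanishing derivative of order at most \<open>m\<close>, if there is one,
  supplies the leading coefficient.\<close>

lemma zero_jet_or_leading_term:
  assumes "open V" "0 \<in> V" "higher_differentiable_on V h m"
  shows "zero_jet m h \<or> (\<exists>b k. k \<le> m \<and> leading_term h b k)"
proof (cases "zero_jet m h")
  case False
  define k where "k = (LEAST k. (deriv ^^ k) h 0 \<noteq> 0)"
  from False obtain j where "j \<le> m" "(deriv ^^ j) h 0 \<noteq> 0"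
    by (auto simp: zero_jet_def)
  then have k: "k \<le> m" "(deriv ^^ k) h 0 \<noteq> 0"
    using Least_le[of "\<lambda>k. (deriv ^^ k) h 0 \<noteq> 0" j] LeastI[of "\<lambda>k. (deriv ^^ k) h 0 \<noteq> 0" j]
    unfolding k_def by auto
  have "(deriv ^^ j) h 0 = 0" if "j < k" for j
    using not_less_Least[OF that[unfolded k_def]] by simp
  with k(2) have "leading_term h ((deriv ^^ k) h 0 / fact k) k"
    using taylor_first_nonzero[OF assms(1,2) higher_differentiable_on_le[OF assms(3) k(1)]]
    by (simp add: leading_term_iff)
  then show ?thesis using k(1) by blast
qed simp

lemma zero_jet_tendsto:
  assumes "open V" "0 \<in> V" "higher_differentiable_on V h m" "zero_jet m h"
  shows "((\<lambda>x. h x / x ^ m) \<longlongrightarrow> 0) (at 0)"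
  using taylor_first_nonzero[OF assms(1-3)] assms(4) by (simp add: zero_jet_def)

text \<open>A dichotomy for transporting limits backwards along the conjugacy: if the quotient by
  \<open>x ^ m\<close> has no limit, a definite smaller order is available to contradict.\<close>

lemma tendsto_or_leading_term:
  assumes "open V" "0 \<in> V" "higher_differentiable_on V h m"
  shows "(\<exists>b. ((\<lambda>x. h x / x ^ m) \<longlongrightarrow> b) (at 0)) \<or> (\<exists>b k. k < m \<and> leading_term h b k)"
  using zero_jet_or_leading_term[OF assms]
proof (elim disjE exE conjE)
  assume "zero_jet m h"
  from zero_jet_tendsto[OF assms this] show ?thesis by blast
next
  fix b k assume "k \<le> m" "leading_term h b k"
  moreover from this have "k = m \<or> k < m" by linarith
  ultimately show ?thesis unfolding leading_term_iff by blast
qed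

text \<open>Both alternatives of \<open>condition_i\<close> express that \<Phi> is negligible
  against \<open>x ^ (n - 1)\<close>; the single limit is easier to transport.\<close>

lemma condition_i_iff:
  assumes "open V" "0 \<in> V" "higher_differentiable_on V \<Phi> (r - 1)" "n < r"
  shows "condition_i r n \<Phi> \<longleftrightarrow> ((\<lambda>x. \<Phi> x / x ^ (n - 1)) \<longlongrightarrow> 0) (at 0)"
proof
  assume "condition_i r n \<Phi>"
  then consider b \<beta> where "leading_term \<Phi> b \<beta>" "n - 1 < \<beta>" | "zero_jet (r - 1) \<Phi>"
    unfolding condition_i_def by blast
  then show "((\<lambda>x. \<Phi> x / x ^ (n - 1)) \<longlongrightarrow> 0) (at 0)"
  proof cases
    case 2
    show ?thesis
    \<comment> \<open>Lowering the exponent needs a strict inequality. Under \<open>n < r\<close> it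
      fails only for \<open>n = 0\<close> and \<open>r = 1\<close>, where subtraction
      truncates.\<close>
    proof (cases "n - 1 = r - 1")
      case True
      then show ?thesis using zero_jet_tendsto[OF assms(1-3) 2] by simp
    next
      case False
      then show ?thesis
        using \<open>n < r\<close> by (intro tendsto_divide_power_less[OF zero_jet_tendsto[OF assms(1-3) 2]]) simp
    qed
  qed (auto simp: leading_term_iff intro: tendsto_divide_power_less)
next
  assume lim: "((\<lambda>x. \<Phi> x / x ^ (n - 1)) \<longlongrightarrow> 0) (at 0)"
  \<comment> \<open>A leading term of order at most \<open>n - 1\<close> would have its nonzero
    coefficient as a limit equal to 0.\<close>
  have "\<beta> > n - 1" if "leading_term \<Phi> b \<beta>" for b \<beta>
  proof (rule ccontr)
    assume "\<not> \<beta> > n - 1"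
    then have "((\<lambda>x. \<Phi> x / x ^ \<beta>) \<longlongrightarrow> 0) (at 0)"
      using lim tendsto_divide_power_less[OF lim, of \<beta>] by (cases "\<beta> = n - 1") auto
    with that show False
      using tendsto_unique[OF at_neq_bot] unfolding leading_term_iff by blast
  qed
  moreover have "zero_jet (r - 1) \<Phi> \<or> (\<exists>b \<beta>. \<beta> \<le> r - 1 \<and> leading_term \<Phi> b \<beta>)"
    by (rule zero_jet_or_leading_term[OF assms(1-3)])
  ultimately show "condition_i r n \<Phi>"
    unfolding condition_i_def by blast
qed

section \<open>Partial derivatives\<close>

text \<open>The direction comes first and the point last, so that \<open>D v g\<close> is again a
  function and can be differentiated further.\<close>

abbreviation D :: "'a::real_normed_vector \<Rightarrow> ('a \<Rightarrow> 'b::real_normed_vector) \<Rightarrow> 'a \<Rightarrow> 'b" where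
  "D v g p \<equiv> frechet_derivative g (at p) v"

lemma has_real_derivative_along:
  fixes g :: "'a::real_normed_vector \<Rightarrow> real"
  assumes "(c has_vector_derivative w) (at t)" "g differentiable at (c t)"
  shows "((\<lambda>t. g (c t)) has_real_derivative D w g (c t)) (at t)"
proof -
  have "(g has_derivative (\<lambda>v. D v g (c t))) (at (c t) within range c)"
    using assms(2) by (simp add: frechet_derivative_works has_derivative_at_withinI)
  then have "((g \<circ> c) has_vector_derivative D w g (c t)) (at t)"
    using vector_derivative_diff_chain_within[of c w t UNIV g] assms(1) by simp
  then show ?thesis
    by (simp add: has_real_derivative_iff_has_vector_derivative o_def)
qed

lemma has_vector_derivative_graph:
  assumes "(F has_real_derivative d) (at x)"
  shows "((\<lambda>x. (x, F x)) has_vector_derivative (1, d)) (at x)"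
  using assms by (intro has_vector_derivative_Pair has_vector_derivative_id)
    (simp add: has_real_derivative_iff_has_vector_derivative)

lemma has_real_derivative_fst:
  fixes g :: "real \<times> real \<Rightarrow> real"
  assumes "g differentiable at (x, y)"
  shows "((\<lambda>s. g (s, y)) has_real_derivative D (1, 0) g (x, y)) (at x)"
  using has_real_derivative_along[of "\<lambda>s. (s, y)" "(1, 0)" x g] assms
  by (simp add: has_vector_derivative_graph)

lemma has_real_derivative_snd:
  fixes g :: "real \<times> real \<Rightarrow> real"
  assumes "g differentiable at (x, y)"
  shows "((\<lambda>t. g (x, t)) has_real_derivative D (0, 1) g (x, y)) (at y)"
  by (rule has_real_derivative_along[OF
        has_vector_derivative_Pair[OF has_vector_derivative_const has_vector_derivative_id] assms])

lemma D_Pair: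
  fixes g :: "real \<times> real \<Rightarrow> 'b::real_normed_vector"
  assumes "g differentiable at p"
  shows "D (a, b) g p = a *\<^sub>R D (1, 0) g p + b *\<^sub>R D (0, 1) g p"
proof -
  have lin: "linear (frechet_derivative g (at p))"
    using assms linear_frechet_derivative by blast
  have "D (a, b) g p = D (a *\<^sub>R (1, 0) + b *\<^sub>R (0, 1)) g p"
    by simp
  also have "\<dots> = a *\<^sub>R D (1, 0) g p + b *\<^sub>R D (0, 1) g p"
    by (simp only: linear_add[OF lin] linear_scale[OF lin])
  finally show ?thesis .
qed

text \<open>The bound on \<xi> is symmetric in \<open>v\<close> and \<open>w\<close>, so their order
  does not matter, equality is allowed, and \<xi> tends to 0 whenever both do.\<close>

lemma mean_value_snd_ex:
  fixes g :: "real \<times> real \<Rightarrow> real"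
  assumes "\<And>t. \<bar>t\<bar> \<le> \<bar>v\<bar> + \<bar>w\<bar> \<Longrightarrow> g differentiable at (u, t)"
  shows "\<exists>\<xi>. \<bar>\<xi>\<bar> \<le> \<bar>v\<bar> + \<bar>w\<bar> \<and> g (u, v) - g (u, w) = D (0, 1) g (u, \<xi>) * (v - w)"
proof -
  have *: "\<exists>\<xi>. \<bar>\<xi>\<bar> \<le> \<bar>a\<bar> + \<bar>b\<bar> \<and> g (u, b) - g (u, a) = D (0, 1) g (u, \<xi>) * (b - a)"
    if "a < b" and diff: "\<And>t. \<bar>t\<bar> \<le> \<bar>a\<bar> + \<bar>b\<bar> \<Longrightarrow> g differentiable at (u, t)" for a b
  proof -
    have "((\<lambda>t. g (u, t)) has_real_derivative D (0, 1) g (u, t)) (at t)" if "a \<le> t" "t \<le> b" for t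
      using that by (intro has_real_derivative_snd diff) linarith
    from MVT2[OF \<open>a < b\<close> this] obtain z where "a < z" "z < b"
      "g (u, b) - g (u, a) = (b - a) * D (0, 1) g (u, z)"
      by blast
    then show ?thesis by (intro exI[of _ z]) (auto simp: mult.commute)
  qed
  consider "v < w" | "v = w" | "w < v" by linarith
  then show ?thesis
  proof cases
    case 1
    with *[of v w] assms obtain \<xi> where "\<bar>\<xi>\<bar> \<le> \<bar>v\<bar> + \<bar>w\<bar>"
      "g (u, w) - g (u, v) = D (0, 1) g (u, \<xi>) * (w - v)" by blast
    then show ?thesis by (intro exI[of _ \<xi>]) (simp add: algebra_simps)
  next
    case 3
    with *[of w v] assms show ?thesis by (simp add: add.commute)
  qed (simp, rule exI[of _ 0], simp)
qed

text \<open>The factor \<open>k\<close> is the partial derivative at an intermediate point; that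
  point tends to 0 and the partial derivative is continuous. The outcome is an exact factorisation
  rather than an estimate.\<close>

lemma mean_value_snd:
  fixes g :: "real \<times> real \<Rightarrow> real"
  assumes "open U" "0 \<in> U" "higher_differentiable_on U g 1"
    and u: "(u \<longlongrightarrow> 0) F" and v: "(v \<longlongrightarrow> 0) F" and w: "(w \<longlongrightarrow> 0) F"
  obtains k where "(k \<longlongrightarrow> D (0, 1) g 0) F"
    "\<forall>\<^sub>F x in F. g (u x, v x) - g (u x, w x) = k x * (v x - w x)"
proof -
  obtain d where d: "d > 0" "ball 0 d \<subseteq> U"
    using assms(1,2) openE by blast
  let ?P = "\<lambda>x \<xi>. \<bar>\<xi>\<bar> \<le> \<bar>v x\<bar> + \<bar>w x\<bar> \<and>
    g (u x, v x) - g (u x, w x) = D (0, 1) g (u x, \<xi>) * (v x - w x)"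
  \<comment> \<open>The intermediate points are chosen independently for each \<open>x\<close>; only
    their convergence to 0 matters.\<close>
  define \<xi> where "\<xi> x = (SOME \<xi>. ?P x \<xi>)" for x
  have "((\<lambda>x. \<bar>u x\<bar> + (\<bar>v x\<bar> + \<bar>w x\<bar>)) \<longlongrightarrow> \<bar>0\<bar> + (\<bar>0\<bar> + \<bar>0\<bar>)) F"
    by (intro tendsto_add tendsto_rabs u v w)
  then have "\<forall>\<^sub>F x in F. \<bar>u x\<bar> + (\<bar>v x\<bar> + \<bar>w x\<bar>) < d"
    using d(1) by (auto dest: order_tendstoD(2))
  then have P: "\<forall>\<^sub>F x in F. ?P x (\<xi> x)"
  proof eventually_elim
    case (elim x)
    have "g differentiable at (u x, t)" if "\<bar>t\<bar> \<le> \<bar>v x\<bar> + \<bar>w x\<bar>" for t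
    proof -
      have "norm (u x, t) < d"
        using norm_Pair_le[of "u x" t] that elim by simp
      then show ?thesis
        using d(2) assms(3) by (auto simp: subset_iff)
    qed
    from mean_value_snd_ex[OF this] show ?case
      unfolding \<xi>_def by (rule someI_ex)
  qed
  have "((\<lambda>x. \<bar>v x\<bar> + \<bar>w x\<bar>) \<longlongrightarrow> \<bar>0\<bar> + \<bar>0\<bar>) F"
    by (intro tendsto_add tendsto_rabs v w)
  then have "((\<lambda>x. \<bar>v x\<bar> + \<bar>w x\<bar>) \<longlongrightarrow> 0) F"
    by simp
  then have "(\<xi> \<longlongrightarrow> 0) F"
    by (rule Lim_null_comparison[rotated]) (use P in eventually_elim, simp)
  with u have "((\<lambda>x. (u x, \<xi> x)) \<longlongrightarrow> 0) F"
    by (auto dest: tendsto_Pair simp: zero_prod_def)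
  moreover have "isCont (D (0, 1) g) 0"
    using assms(1-3) by (simp add: continuous_on_eq_continuous_at)
  ultimately have "((\<lambda>x. D (0, 1) g (u x, \<xi> x)) \<longlongrightarrow> D (0, 1) g 0) F"
    by (rule isCont_tendsto_compose[rotated])
  then show thesis
    by (rule that) (use P in eventually_elim, simp)
qed

section \<open>The divergence along the curve of vertical directions\<close>

text \<open>This is the divergence of \<open>vf P Q\<close>: the summand \<open>snd p\<close> of its
  first component is constant in the first variable.\<close>

abbreviation divergence ::
    "(real \<times> real \<Rightarrow> real) \<Rightarrow> (real \<times> real \<Rightarrow> real) \<Rightarrow> real \<times> real \<Rightarrow> real" where
  "divergence P Q p \<equiv> D (1, 0) P p + D (0, 1) Q p"

lemma Phi_of_eq:
  assumes "P differentiable at (x, F x)" "Q differentiable at (x, F x)"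
  shows "Phi_of P Q F x = divergence P Q (x, F x)"
  using has_real_derivative_fst[OF assms(1)] has_real_derivative_snd[OF assms(2)]
  by (simp add: Phi_of_def DERIV_imp_deriv)

lemma higher_differentiable_on_graph:
  assumes "open V" "higher_differentiable_on V F k"
  shows "higher_differentiable_on V (\<lambda>x::real. (x, F x :: real)) k"
proof -
  have "bounded_linear (\<lambda>x::real. (x, 0::real))"
    by (intro bounded_linear_Pair bounded_linear_ident bounded_linear_zero)
  then have 1: "higher_differentiable_on V (\<lambda>x::real. (x, 0::real)) k"
    by (rule higher_differentiable_on_bounded_linear[OF assms(1) _ higher_differentiable_on_ident[OF assms(1)]])
  have "bounded_linear (\<lambda>y::real. (0::real, y))"
    by (intro bounded_linear_Pair bounded_linear_ident bounded_linear_zero)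
  then have 2: "higher_differentiable_on V (\<lambda>x. (0::real, F x)) k"
    by (rule higher_differentiable_on_bounded_linear[OF assms(1) _ assms(2)])
  show ?thesis
    using higher_differentiable_on_add[OF assms(1) 1 2] by simp
qed

section \<open>Regularity and tangent of the data of a nilpotent system\<close>

lemma nilpotent_systemE:
  assumes "nilpotent_system r P Q"
  obtains U where "open U" "0 \<in> U" "higher_differentiable_on U P r" "higher_differentiable_on U Q r"
    "P 0 = 0" "Q 0 = 0" "frechet_derivative P (at 0) = (\<lambda>v. 0)" "frechet_derivative Q (at 0) = (\<lambda>v. 0)"
proof -
  obtain U V where "open U" "0 \<in> U" "higher_differentiable_on U P r"
    and "open V" "0 \<in> V" "higher_differentiable_on V Q r"
    using assms by (auto simp: nilpotent_system_def C_near_0_def)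
  then show thesis
    using assms frechet_derivative_at[of P "\<lambda>_. 0" 0] frechet_derivative_at[of Q "\<lambda>_. 0" 0]
      higher_differentiable_on_subset[of U P r "U \<inter> V"] higher_differentiable_on_subset[of V Q r "U \<inter> V"]
    by (intro that[of "U \<inter> V"])
      (auto simp: nilpotent_system_def zero_1_jet_def fun_eq_iff)
qed

text \<open>Locally \<Phi> is the divergence composed with the graph map of \<open>F\<close>; taking
  the divergence costs one derivative.\<close>

lemma Phi_of_higher_differentiable:
  assumes "nilpotent_system r P Q" "implicit_solution r P F" "r \<ge> 1"
  obtains V where "open V" "0 \<in> V" "higher_differentiable_on V (Phi_of P Q F) (r - 1)"
proof -
  obtain k where r: "r = Suc k" using assms(3) by (cases r) auto
  obtain U where U: "open U" "0 \<in> U" "higher_differentiable_on U P r" "higher_differentiable_on U Q r"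
    by (rule nilpotent_systemE[OF assms(1)])
  obtain W where W: "open W" "0 \<in> W" "higher_differentiable_on W F r" and "F 0 = 0"
    using assms(2) by (auto simp: implicit_solution_def C_near_0_def)
  let ?c = "\<lambda>x. (x, F x)"
  define V where "V = W \<inter> ?c -` U"
  have c: "higher_differentiable_on W ?c k"
    by (rule higher_differentiable_on_graph[OF W(1) higher_differentiable_on_Suc_imp[OF W(3)[unfolded r]]])
  then have "continuous_on W ?c"
    using higher_differentiable_on_le[OF c, of 0] by simp
  then have V: "open V"
    unfolding V_def using W(1) U(1) by (rule continuous_open_preimage)
  have "0 \<in> V"
    using U W \<open>F 0 = 0\<close> by (simp add: V_def zero_prod_def)
  have c: "higher_differentiable_on V ?c k"
    using c by (rule higher_differentiable_on_subset) (simp add: V_def)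
  have div: "higher_differentiable_on U (divergence P Q) k"
    by (rule higher_differentiable_on_add[OF U(1)]) (use U(3,4) r in simp_all)
  have "higher_differentiable_on V (\<lambda>x. divergence P Q (?c x)) k"
    by (rule higher_differentiable_on_compose[OF U(1) V _ div c]) (auto simp: V_def)
  then have "higher_differentiable_on V (Phi_of P Q F) k"
  proof (rule higher_differentiable_on_cong[OF V, rotated])
    fix x assume "x \<in> V"
    then have "?c x \<in> U" by (simp add: V_def)
    with U(3,4) have "P differentiable at (?c x)" "Q differentiable at (?c x)"
      unfolding r by simp_all
    then show "divergence P Q (?c x) = Phi_of P Q F x"
      by (rule Phi_of_eq[symmetric])
  qed
  then show thesis
    using that[OF V \<open>0 \<in> V\<close>] unfolding r by simp
qed

text \<open>Differentiating \<open>F x + P (x, F x) = 0\<close> at 0 leaves only the derivative of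
  \<open>F\<close>, since \<open>P\<close> has zero 1-jet. The curve of vertical directions is thus
  tangent to the first axis.\<close>

lemma implicit_solution_derivative:
  assumes "nilpotent_system r P Q" "implicit_solution r P F" "r \<ge> 1"
  shows "(F has_real_derivative 0) (at 0)"
proof -
  obtain k where r: "r = Suc k" using assms(3) by (cases r) auto
  obtain U where U: "open U" "0 \<in> U" "higher_differentiable_on U P r" "frechet_derivative P (at 0) = (\<lambda>v. 0)"
    by (rule nilpotent_systemE[OF assms(1)])
  obtain W where W: "open W" "0 \<in> W" "higher_differentiable_on W F r" and "F 0 = 0"
    and F: "\<forall>\<^sub>F x in nhds 0. F x + P (x, F x) = 0"
    using assms(2) by (auto simp: implicit_solution_def C_near_0_def)
  have F': "(F has_real_derivative deriv F 0) (at 0)"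
    using higher_differentiable_on_deriv(1)[OF W(1)] W(2,3) unfolding r by blast
  have "P differentiable at (0, F 0)"
    using U unfolding r by (simp add: \<open>F 0 = 0\<close> zero_prod_def)
  from has_real_derivative_along[OF has_vector_derivative_graph[OF F'] this]
  have "((\<lambda>x. P (x, F x)) has_real_derivative 0) (at 0)"
    using U(4) by (simp add: \<open>F 0 = 0\<close> zero_prod_def)
  from DERIV_add[OF F' this] have "((\<lambda>x. F x + P (x, F x)) has_real_derivative deriv F 0) (at 0)"
    by simp
  then have "((\<lambda>x. 0) has_real_derivative deriv F 0) (at (0::real))"
    using DERIV_cong_ev[OF refl F refl] by blast
  then have "deriv F 0 = 0"
    using DERIV_unique DERIV_const by blast
  with F' show ?thesis by simp
qed

text \<open>The conjugacy identity is differentiated in direction \<open>w\<close>: product rule on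
  the left, chain rule on the right. The \<open>snd\<close> terms come from the linear part of
  \<open>vf\<close>.\<close>

lemma conjugates_derivative:
  fixes \<phi> :: "real \<times> real \<Rightarrow> real \<times> real"
  assumes conj: "\<forall>\<^sub>F q in nhds p. D (vf P\<^sub>Y Q\<^sub>Y q) \<phi> q = vf P\<^sub>X Q\<^sub>X (\<phi> q)"
    and \<phi>: "\<forall>\<^sub>F q in nhds p. \<phi> differentiable at q"
    and D\<phi>: "\<And>v. (\<lambda>q. D v \<phi> q) differentiable at p"
    and Y: "P\<^sub>Y differentiable at p" "Q\<^sub>Y differentiable at p"
    and X: "P\<^sub>X differentiable at (\<phi> p)" "Q\<^sub>X differentiable at (\<phi> p)"
  shows "(snd w + D w P\<^sub>Y p) *\<^sub>R D (1, 0) \<phi> p + D w Q\<^sub>Y p *\<^sub>R D (0, 1) \<phi> p +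
      (snd p + P\<^sub>Y p) *\<^sub>R D w (\<lambda>q. D (1, 0) \<phi> q) p + Q\<^sub>Y p *\<^sub>R D w (\<lambda>q. D (0, 1) \<phi> q) p =
    (snd (D w \<phi> p) + D (D w \<phi> p) P\<^sub>X (\<phi> p), D (D w \<phi> p) Q\<^sub>X (\<phi> p))"
proof -
  note works = frechet_derivative_works[THEN iffD1]
  \<comment> \<open>The left side of the conjugacy is written through the two partial derivatives of
    \<phi>, because its direction varies with \<open>q\<close>.\<close>
  define G where "G q = (snd q + P\<^sub>Y q) *\<^sub>R D (1, 0) \<phi> q + Q\<^sub>Y q *\<^sub>R D (0, 1) \<phi> q" for q
  have G: "(G has_derivative (\<lambda>w.
      ((snd p + P\<^sub>Y p) *\<^sub>R D w (\<lambda>q. D (1, 0) \<phi> q) p + (snd w + D w P\<^sub>Y p) *\<^sub>R D (1, 0) \<phi> p) +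
      (Q\<^sub>Y p *\<^sub>R D w (\<lambda>q. D (0, 1) \<phi> q) p + D w Q\<^sub>Y p *\<^sub>R D (0, 1) \<phi> p))) (at p)"
    unfolding G_def
    by (rule has_derivative_add[OF
          has_derivative_scaleR[OF
            has_derivative_add[OF has_derivative_snd[OF has_derivative_ident] works[OF Y(1)]] works[OF D\<phi>]]
          has_derivative_scaleR[OF works[OF Y(2)] works[OF D\<phi>]]])
  have p: "\<phi> differentiable at p"
    using \<phi> by (rule eventually_nhds_x_imp_x)
  have X': "((\<lambda>q. vf P\<^sub>X Q\<^sub>X (\<phi> q)) has_derivative (\<lambda>w.
      (snd (D w \<phi> p) + D (D w \<phi> p) P\<^sub>X (\<phi> p), D (D w \<phi> p) Q\<^sub>X (\<phi> p)))) (at p)"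
    unfolding vf_def
    by (rule has_derivative_Pair[OF
          has_derivative_add[OF has_derivative_snd[OF works[OF p]]
            has_derivative_compose[OF works[OF p] works[OF X(1)]]]
          has_derivative_compose[OF works[OF p] works[OF X(2)]]])
  have eq: "\<forall>\<^sub>F q in nhds p. G q = vf P\<^sub>X Q\<^sub>X (\<phi> q)"
    using conj \<phi>
  proof eventually_elim
    case (elim q)
    have "G q = D (snd q + P\<^sub>Y q, Q\<^sub>Y q) \<phi> q"
      unfolding G_def by (rule D_Pair[OF elim(2), symmetric])
    with elim(1) show ?case by (simp add: vf_def)
  qed
  have "(G has_derivative (\<lambda>w.
      (snd (D w \<phi> p) + D (D w \<phi> p) P\<^sub>X (\<phi> p), D (D w \<phi> p) Q\<^sub>X (\<phi> p)))) (at p)"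
  proof (rule has_derivative_transform_eventually[OF X'])
    show "\<forall>\<^sub>F q in at p. vf P\<^sub>X Q\<^sub>X (\<phi> q) = G q"
      using eventually_at_filter[of _ p UNIV] eq by (auto elim: eventually_mono)
    show "vf P\<^sub>X Q\<^sub>X (\<phi> p) = G p"
      using eventually_nhds_x_imp_x[OF eq] by simp
  qed simp
  from fun_cong[OF has_derivative_unique[OF G this], of w] show ?thesis
    by (simp only: add_ac)
qed

text \<open>At a point where the field \<open>Y\<close> is vertical, so that \<open>Y = (0, Q\<^sub>Y)\<close>, the identity
  \<open>D\<phi> DY + D\<^sup>2\<phi>(Y, \<cdot>) = DX(\<phi>) D\<phi>\<close> is multiplied by the adjugate of \<open>D\<phi>\<close> and the trace is taken.\<close>

lemma conjugates_divergence:
  fixes \<phi> :: "real \<times> real \<Rightarrow> real \<times> real"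
  assumes conj: "\<forall>\<^sub>F q in nhds p. D (vf P\<^sub>Y Q\<^sub>Y q) \<phi> q = vf P\<^sub>X Q\<^sub>X (\<phi> q)"
    and \<phi>: "\<forall>\<^sub>F q in nhds p. \<phi> differentiable at q"
    and D\<phi>: "\<And>v. (\<lambda>q. D v \<phi> q) differentiable at p"
    and Y: "P\<^sub>Y differentiable at p" "Q\<^sub>Y differentiable at p"
    and X: "P\<^sub>X differentiable at (\<phi> p)" "Q\<^sub>X differentiable at (\<phi> p)"
    and vertical: "snd p + P\<^sub>Y p = 0"
  defines "a \<equiv> D (1, 0) \<phi> p" and "b \<equiv> D (0, 1) \<phi> p"
    and "m \<equiv> D (1, 0) (\<lambda>q. D (0, 1) \<phi> q) p" and "l \<equiv> D (0, 1) (\<lambda>q. D (0, 1) \<phi> q) p"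
  shows "(fst a * snd b - snd a * fst b) * (divergence P\<^sub>X Q\<^sub>X (\<phi> p) - divergence P\<^sub>Y Q\<^sub>Y p) =
    Q\<^sub>Y p * (snd b * fst m - fst b * snd m - snd a * fst l + fst a * snd l)"
proof -
  note eq = conjugates_derivative[OF conj \<phi> D\<phi> Y X, unfolded vertical]
  obtain a1 a2 b1 b2 m1 m2 l1 l2 where
    ab: "a = (a1, a2)" "b = (b1, b2)" "m = (m1, m2)" "l = (l1, l2)"
    by (rule that[of "fst a" "snd a" "fst b" "snd b" "fst m" "snd m" "fst l" "snd l"]) simp_all
  define c11 c12 c21 c22 where "c11 = D (1, 0) P\<^sub>X (\<phi> p)" and "c12 = 1 + D (0, 1) P\<^sub>X (\<phi> p)"
    and "c21 = D (1, 0) Q\<^sub>X (\<phi> p)" and "c22 = D (0, 1) Q\<^sub>X (\<phi> p)"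
  define y11 y12 y21 y22 where "y11 = D (1, 0) P\<^sub>Y p" and "y12 = 1 + D (0, 1) P\<^sub>Y p"
    and "y21 = D (1, 0) Q\<^sub>Y p" and "y22 = D (0, 1) Q\<^sub>Y p"
  \<comment> \<open>\<open>e\<close> and \<open>f\<close> are the two columns of the matrix
    identity. Verticality leaves only \<open>Q\<^sub>Y p\<close> times second derivatives of \<phi>,
    and the 1 in \<open>c12\<close> and \<open>y12\<close> is the linear part of the fields.\<close>
  have e: "y11 * a1 + y21 * b1 + Q\<^sub>Y p * m1 = c11 * a1 + c12 * a2"
    "y11 * a2 + y21 * b2 + Q\<^sub>Y p * m2 = c21 * a1 + c22 * a2"
    using eq[of "(1, 0)", folded a_def b_def m_def l_def] unfolding ab D_Pair[OF X(1), of a1 a2] D_Pair[OF X(2), of a1 a2]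
    by (simp_all add: c11_def c12_def c21_def c22_def y11_def y21_def algebra_simps)
  have f: "y12 * a1 + y22 * b1 + Q\<^sub>Y p * l1 = c11 * b1 + c12 * b2"
    "y12 * a2 + y22 * b2 + Q\<^sub>Y p * l2 = c21 * b1 + c22 * b2"
    using eq[of "(0, 1)", folded a_def b_def m_def l_def] unfolding ab D_Pair[OF X(1), of b1 b2] D_Pair[OF X(2), of b1 b2]
    by (simp_all add: c11_def c12_def c21_def c22_def y12_def y22_def algebra_simps)
  \<comment> \<open>The weights \<open>b2\<close>, \<open>-b1\<close>, \<open>-a2\<close>,
    \<open>a1\<close> form the adjugate of the matrix with columns \<open>a\<close> and
    \<open>b\<close>. In the trace the off-diagonal entries cancel and each diagonal sum is
    multiplied by the determinant.\<close>
  have "b2 * (y11 * a1 + y21 * b1 + Q\<^sub>Y p * m1) - b1 * (y11 * a2 + y21 * b2 + Q\<^sub>Y p * m2) -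
      a2 * (y12 * a1 + y22 * b1 + Q\<^sub>Y p * l1) + a1 * (y12 * a2 + y22 * b2 + Q\<^sub>Y p * l2) =
    b2 * (c11 * a1 + c12 * a2) - b1 * (c21 * a1 + c22 * a2) -
      a2 * (c11 * b1 + c12 * b2) + a1 * (c21 * b1 + c22 * b2)"
    unfolding e f ..
  then have "(a1 * b2 - a2 * b1) * ((c11 + c22) - (y11 + y22)) =
      Q\<^sub>Y p * (b2 * m1 - b1 * m2 - a2 * l1 + a1 * l2)"
    by (simp add: algebra_simps)
  then show ?thesis
    by (simp add: ab c11_def c22_def y11_def y22_def)
qed

text \<open>Differentiating \<psi> after \<phi> at 0 gives the identity, so the derivative of \<phi>
  there is injective.\<close>

lemma local_diffeo_derivative_nonzero:
  assumes "local_diffeo r \<phi>" "r \<ge> 1" "v \<noteq> 0"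
  shows "D v \<phi> 0 \<noteq> 0"
proof
  assume 0: "D v \<phi> 0 = 0"
  obtain k where r: "r = Suc k" using assms(2) by (cases r) auto
  obtain U V \<psi> where U: "open U" "open V" "0 \<in> U" "homeomorphism U V \<phi> \<psi>"
    "higher_differentiable_on U \<phi> r" "higher_differentiable_on V \<psi> r"
    using assms(1) unfolding local_diffeo_def by blast
  have "\<phi> 0 \<in> V"
    using homeomorphism_image1[OF U(4)] U(3) by blast
  have \<phi>: "(\<phi> has_derivative (\<lambda>v. D v \<phi> 0)) (at 0)"
    using higher_differentiable_on_SucD[OF U(5)[unfolded r] U(3)] .
  have \<psi>: "(\<psi> has_derivative (\<lambda>v. D v \<psi> (\<phi> 0))) (at (\<phi> 0))"
    using higher_differentiable_on_SucD[OF U(6)[unfolded r] \<open>\<phi> 0 \<in> V\<close>] .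
  have "((\<lambda>p. \<psi> (\<phi> p)) has_derivative (\<lambda>v. v)) (at 0)"
    by (rule has_derivative_transform_within_open[OF has_derivative_ident U(1,3)])
      (simp add: homeomorphism_apply1[OF U(4)])
  from fun_cong[OF has_derivative_unique[OF has_derivative_compose[OF \<phi> \<psi>] this], of v]
  have "D 0 \<psi> (\<phi> 0) = v"
    by (simp add: 0)
  with linear_0[OF has_derivative_linear[OF \<psi>]] \<open>v \<noteq> 0\<close> show False
    by simp
qed

lemma higher_differentiable_on_isCont:
  assumes "open U" "x \<in> U" "higher_differentiable_on U f k"
  shows "isCont f x"
  using higher_differentiable_on_le[OF assms(3), of 0] assms(1,2)
  by (simp add: continuous_on_eq_continuous_at)

text \<open>The curve where \<open>Y\<close> is vertical is sent to \<open>x \<mapsto> (u x, v x)\<close>, along which \<open>X = D\<phi> (0, f\<^sub>Y)\<close>.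
  So \<open>v\<close> differs from \<open>F\<^sub>X \<circ> u\<close>, and then \<open>\<Phi>\<^sub>X \<circ> u\<close> from \<open>\<Phi>\<^sub>Y\<close>, by \<open>O(f\<^sub>Y)\<close> only.\<close>

lemma conjugates_asymptotics:
  assumes "r \<ge> 2"
    and X: "nilpotent_system r P\<^sub>X Q\<^sub>X" "implicit_solution r P\<^sub>X F\<^sub>X"
    and Y: "nilpotent_system r P\<^sub>Y Q\<^sub>Y" "implicit_solution r P\<^sub>Y F\<^sub>Y"
    and diffeo: "local_diffeo r \<phi>" and conj: "conjugates \<phi> (vf P\<^sub>Y Q\<^sub>Y) (vf P\<^sub>X Q\<^sub>X)"
  obtains \<alpha> c :: real and u \<kappa> \<mu> :: "real \<Rightarrow> real" where "\<alpha> \<noteq> 0" "((\<lambda>x. u x / x) \<longlongrightarrow> \<alpha>) (at 0)"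
    "(\<kappa> \<longlongrightarrow> c) (at 0)" "(\<mu> \<longlongrightarrow> \<alpha>) (at 0)"
    "\<forall>\<^sub>F x in at 0. Phi_of P\<^sub>Y Q\<^sub>Y F\<^sub>Y x - Phi_of P\<^sub>X Q\<^sub>X F\<^sub>X (u x) = \<kappa> x * f_of Q\<^sub>Y F\<^sub>Y x"
    "\<forall>\<^sub>F x in at 0. f_of Q\<^sub>X F\<^sub>X (u x) = \<mu> x * f_of Q\<^sub>Y F\<^sub>Y x"
proof -
  obtain k where r: "r = Suc (Suc k)"
    using assms(1) by (metis add_2_eq_Suc le_Suc_ex)
  obtain U\<^sub>X where UX: "open U\<^sub>X" "0 \<in> U\<^sub>X"
    "higher_differentiable_on U\<^sub>X P\<^sub>X r" "higher_differentiable_on U\<^sub>X Q\<^sub>X r"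
    and X0: "P\<^sub>X 0 = 0" "Q\<^sub>X 0 = 0" "frechet_derivative P\<^sub>X (at 0) = (\<lambda>v. 0)" "frechet_derivative Q\<^sub>X (at 0) = (\<lambda>v. 0)"
    by (rule nilpotent_systemE[OF X(1)])
  obtain U\<^sub>Y where UY: "open U\<^sub>Y" "0 \<in> U\<^sub>Y"
    "higher_differentiable_on U\<^sub>Y P\<^sub>Y r" "higher_differentiable_on U\<^sub>Y Q\<^sub>Y r"
    and Y0: "P\<^sub>Y 0 = 0" "Q\<^sub>Y 0 = 0" "frechet_derivative P\<^sub>Y (at 0) = (\<lambda>v. 0)" "frechet_derivative Q\<^sub>Y (at 0) = (\<lambda>v. 0)"
    by (rule nilpotent_systemE[OF Y(1)])
  obtain U where U: "open U" "0 \<in> U" "higher_differentiable_on U \<phi> r" and \<phi>0: "\<phi> 0 = 0"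
    using diffeo unfolding local_diffeo_def by blast
  obtain W where W: "open W" "0 \<in> W" "higher_differentiable_on W F\<^sub>X r" and FX0: "F\<^sub>X 0 = 0"
    and FX: "\<forall>\<^sub>F x in nhds 0. F\<^sub>X x + P\<^sub>X (x, F\<^sub>X x) = 0"
    using X(2) unfolding implicit_solution_def C_near_0_def by blast
  have FY0: "F\<^sub>Y 0 = 0" and FY: "\<forall>\<^sub>F x in nhds 0. F\<^sub>Y x + P\<^sub>Y (x, F\<^sub>Y x) = 0"
    using Y(2) unfolding implicit_solution_def by blast+
  have FY': "(F\<^sub>Y has_real_derivative 0) (at 0)"
    using implicit_solution_derivative[OF Y] r by simp

  have conj: "\<forall>\<^sub>F p in nhds 0. D (vf P\<^sub>Y Q\<^sub>Y p) \<phi> p = vf P\<^sub>X Q\<^sub>X (\<phi> p)"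
    using conj by (simp add: conjugates_def)
  have diff_U: "\<phi> differentiable at p" "(\<lambda>q. D v \<phi> q) differentiable at p" if "p \<in> U" for p v
    using U(3) that unfolding r by (simp_all del: split_paired_All)
  have diff_UX: "P\<^sub>X differentiable at p" "Q\<^sub>X differentiable at p" if "p \<in> U\<^sub>X" for p
    using UX(3,4) that unfolding r by simp_all
  have diff_UY: "P\<^sub>Y differentiable at p" "Q\<^sub>Y differentiable at p" if "p \<in> U\<^sub>Y" for p
    using UY(3,4) that unfolding r by simp_all
  have near_U: "\<forall>\<^sub>F p in nhds 0. \<phi> differentiable at p"
    using eventually_nhds_in_open[OF U(1,2)] by eventually_elim (rule diff_U(1))

  define a b where "a = D (1, 0) \<phi>" and "b = D (0, 1) \<phi>"
  define m l where "m = D (1, 0) b" and "l = D (0, 1) b"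
  define \<alpha> where "\<alpha> = snd (b 0)"
  \<comment> \<open>At the origin both fields vanish and their linear part sends
    \<open>(0, 1)\<close> to \<open>(1, 0)\<close> and \<open>(1, 0)\<close> to 0. The
    differentiated conjugacy in direction \<open>(0, 1)\<close> therefore fixes the first column of
    the derivative of \<phi>.\<close>
  have a0: "a 0 = (\<alpha>, 0)"
    using conjugates_derivative[OF conj near_U diff_U(2)[OF U(2)] diff_UY[OF UY(2)], unfolded \<phi>0, OF diff_UX[OF UX(2)], of "(0, 1)"]
    by (simp add: \<phi>0 X0 Y0 a_def b_def \<alpha>_def)
  have "a 0 \<noteq> 0"
    using local_diffeo_derivative_nonzero[OF diffeo, of "(1, 0)"] r by (simp add: a_def zero_prod_def)
  with a0 have "\<alpha> \<noteq> 0" by (auto simp: zero_prod_def)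

  have cont_a: "isCont a 0" and cont_b: "isCont b 0"
    unfolding a_def b_def using diff_U(2)[OF U(2)] by (auto intro: differentiable_imp_continuous_within)
  have cont_m: "isCont m 0" and cont_l: "isCont l 0"
    unfolding m_def l_def b_def
    by (rule higher_differentiable_on_isCont[OF U(1,2), of _ k], use U(3) r in \<open>simp del: split_paired_All\<close>)+
  \<comment> \<open>\<open>J\<close> is the Jacobian determinant of \<phi>, and \<open>K\<close> is
    the bracket on the right of \<open>conjugates_divergence\<close>.\<close>
  define J where "J p = fst (a p) * snd (b p) - snd (a p) * fst (b p)" for p
  define K where "K p = snd (b p) * fst (m p) - fst (b p) * snd (m p) -
    snd (a p) * fst (l p) + fst (a p) * snd (l p)" for p

  define c where "c x = (x, F\<^sub>Y x)" for x
  define u v where "u x = fst (\<phi> (c x))" and "v x = snd (\<phi> (c x))" for x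
  have c0: "c 0 = 0" by (simp add: c_def FY0 zero_prod_def)
  have c': "(c has_vector_derivative (1, 0)) (at 0)"
    unfolding c_def[abs_def] by (rule has_vector_derivative_graph[OF FY'])
  have "isCont c 0"
    using c' has_vector_derivative_continuous by blast
  then have c: "(c \<longlongrightarrow> 0) (at 0)"
    by (simp add: isCont_def c0)
  have \<phi>c': "((\<lambda>x. \<phi> (c x)) has_vector_derivative a 0) (at 0)"
  proof -
    have "(\<phi> has_derivative (\<lambda>v. D v \<phi> (c 0))) (at (c 0) within range c)"
      using diff_U(1)[OF U(2)] by (simp add: c0 frechet_derivative_works has_derivative_at_withinI)
    from vector_derivative_diff_chain_within[OF c' this]
    show ?thesis by (simp add: o_def a_def c0)
  qed
  have \<phi>c: "((\<lambda>x. \<phi> (c x)) \<longlongrightarrow> 0) (at 0)"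
    using has_vector_derivative_continuous[OF \<phi>c'] by (simp add: continuous_at isCont_def c0 \<phi>0)
  have "(u has_real_derivative \<alpha>) (at 0)"
    using bounded_linear.has_vector_derivative[OF bounded_linear_fst \<phi>c']
    by (simp add: has_real_derivative_iff_has_vector_derivative u_def[abs_def] a0)
  then have u': "((\<lambda>x. u x / x) \<longlongrightarrow> \<alpha>) (at 0)"
    by (simp add: DERIV_def u_def c0 \<phi>0)
  have u: "(u \<longlongrightarrow> 0) (at 0)" and v: "(v \<longlongrightarrow> 0) (at 0)"
    unfolding u_def[abs_def] v_def[abs_def] using tendsto_fst[OF \<phi>c] tendsto_snd[OF \<phi>c] by simp_all
  have "isCont F\<^sub>X 0"
    by (rule higher_differentiable_on_isCont[OF W])
  then have Fu: "((\<lambda>x. F\<^sub>X (u x)) \<longlongrightarrow> 0) (at 0)"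
    using isCont_tendsto_compose[OF _ u, of F\<^sub>X] by (simp add: FX0)

  have C1: "higher_differentiable_on U\<^sub>X P\<^sub>X 1" "higher_differentiable_on U\<^sub>X Q\<^sub>X 1"
    using higher_differentiable_on_le[OF UX(3), of 1] higher_differentiable_on_le[OF UX(4), of 1] r
    by simp_all
  have C1': "higher_differentiable_on U\<^sub>X (divergence P\<^sub>X Q\<^sub>X) 1"
  proof (rule higher_differentiable_on_le)
    show "higher_differentiable_on U\<^sub>X (divergence P\<^sub>X Q\<^sub>X) (Suc k)"
      using UX(3,4) unfolding r higher_differentiable_on.simps(2)[of _ _ "Suc k"]
      by (intro higher_differentiable_on_add[OF UX(1)]) blast+
  qed simp
  \<comment> \<open>Three vertical increments between the image point and the curve of
    \<open>F\<^sub>X\<close>. The factors \<open>k1\<close> and \<open>k2\<close> tend to 0 by the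
    vanishing 1-jets; for \<open>k3\<close> a finite limit suffices.\<close>
  obtain k1 where k1: "(k1 \<longlongrightarrow> 0) (at 0)"
    "\<forall>\<^sub>F x in at 0. P\<^sub>X (u x, v x) - P\<^sub>X (u x, F\<^sub>X (u x)) = k1 x * (v x - F\<^sub>X (u x))"
    using mean_value_snd[OF UX(1,2) C1(1) u v Fu] unfolding X0 .
  obtain k2 where k2: "(k2 \<longlongrightarrow> 0) (at 0)"
    "\<forall>\<^sub>F x in at 0. Q\<^sub>X (u x, v x) - Q\<^sub>X (u x, F\<^sub>X (u x)) = k2 x * (v x - F\<^sub>X (u x))"
    using mean_value_snd[OF UX(1,2) C1(2) u v Fu] unfolding X0 .
  obtain k3 where k3: "(k3 \<longlongrightarrow> D (0, 1) (divergence P\<^sub>X Q\<^sub>X) 0) (at 0)"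
    "\<forall>\<^sub>F x in at 0. divergence P\<^sub>X Q\<^sub>X (u x, v x) - divergence P\<^sub>X Q\<^sub>X (u x, F\<^sub>X (u x)) =
      k3 x * (v x - F\<^sub>X (u x))"
    by (rule mean_value_snd[OF UX(1,2) C1' u v Fu])

  \<comment> \<open>With \<open>f\<close> the value of \<open>f_of Q\<^sub>Y F\<^sub>Y\<close> at
    \<open>x\<close>, the vertical gap \<open>v x - F\<^sub>X (u x)\<close> will be \<open>f\<close>
    times \<open>fst (b (c x)) / (1 + k1 x)\<close>. Inserting this into the increments of the
    divergence and of \<open>Q\<^sub>X\<close> produces \<kappa> and \<mu>.\<close>
  define \<kappa> where "\<kappa> x = k3 x * (fst (b (c x)) / (1 + k1 x)) - K (c x) / J (c x)" for x
  define \<mu> where "\<mu> x = snd (b (c x)) - k2 x * (fst (b (c x)) / (1 + k1 x))" for x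
  note lim = isCont_tendsto_compose[OF _ c]
  note lims = lim[OF cont_a] lim[OF cont_b] lim[OF cont_m] lim[OF cont_l]
  have J: "((\<lambda>x. J (c x)) \<longlongrightarrow> \<alpha> * \<alpha>) (at 0)"
  proof -
    have "((\<lambda>x. J (c x)) \<longlongrightarrow> J 0) (at 0)"
      unfolding J_def by (intro tendsto_diff tendsto_mult tendsto_fst tendsto_snd lims)
    then show ?thesis by (simp add: J_def a0 flip: \<alpha>_def)
  qed
  have K: "((\<lambda>x. K (c x)) \<longlongrightarrow> K 0) (at 0)"
    unfolding K_def by (intro tendsto_add tendsto_diff tendsto_mult tendsto_fst tendsto_snd lims)
  have k1': "((\<lambda>x. 1 + k1 x) \<longlongrightarrow> 1) (at 0)"
    using tendsto_add[OF tendsto_const k1(1), of 1] by simp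
  have b1: "((\<lambda>x. fst (b (c x)) / (1 + k1 x)) \<longlongrightarrow> fst (b 0) / 1) (at 0)"
    by (rule tendsto_divide[OF tendsto_fst[OF lims(2)] k1']) simp
  have "(\<kappa> \<longlongrightarrow> D (0, 1) (divergence P\<^sub>X Q\<^sub>X) 0 * (fst (b 0) / 1) - K 0 / (\<alpha> * \<alpha>)) (at 0)"
    unfolding \<kappa>_def[abs_def] using \<open>\<alpha> \<noteq> 0\<close>
    by (intro tendsto_diff tendsto_mult[OF k3(1) b1] tendsto_divide[OF K J]) simp
  moreover have "(\<mu> \<longlongrightarrow> snd (b 0) - 0 * (fst (b 0) / 1)) (at 0)"
    unfolding \<mu>_def[abs_def] by (intro tendsto_diff tendsto_mult[OF k2(1) b1] tendsto_snd lims)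
  then have "(\<mu> \<longlongrightarrow> \<alpha>) (at 0)"
    by (simp add: \<alpha>_def)

  moreover
  have in_U: "\<forall>\<^sub>F x in at 0. c x \<in> U" and in_UY: "\<forall>\<^sub>F x in at 0. c x \<in> U\<^sub>Y"
    using c U(1,2) UY(1,2) by (auto dest: topological_tendstoD)
  have in_UX: "\<forall>\<^sub>F x in at 0. \<phi> (c x) \<in> U\<^sub>X"
    using \<phi>c UX(1,2) by (auto dest: topological_tendstoD)
  have "((\<lambda>x. (u x, F\<^sub>X (u x))) \<longlongrightarrow> 0) (at 0)"
    using tendsto_Pair[OF u Fu] by (simp add: zero_prod_def)
  then have in_UX': "\<forall>\<^sub>F x in at 0. (u x, F\<^sub>X (u x)) \<in> U\<^sub>X"
    using UX(1,2) by (auto dest: topological_tendstoD)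
  \<comment> \<open>\<open>conjugates_divergence\<close> differentiates at \<open>c x\<close>, so
    the conjugacy is needed in a whole neighbourhood of each such point.\<close>
  have near_c: "\<forall>\<^sub>F x in at 0. \<forall>\<^sub>F q in nhds (c x). R q" if "\<forall>\<^sub>F q in nhds 0. R q" for R
  proof -
    from that have "\<forall>\<^sub>F p in nhds 0. \<forall>\<^sub>F q in nhds p. R q"
      by (simp only: eventually_eventually)
    then show ?thesis using c by (rule eventually_compose_filterlim)
  qed
  have FXu: "\<forall>\<^sub>F x in at 0. F\<^sub>X (u x) + P\<^sub>X (u x, F\<^sub>X (u x)) = 0"
    using FX u by (rule eventually_compose_filterlim)
  have FYx: "\<forall>\<^sub>F x in at 0. F\<^sub>Y x + P\<^sub>Y (x, F\<^sub>Y x) = 0"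
    using FY unfolding eventually_at_filter by eventually_elim simp
  \<comment> \<open>Since \<open>J (c x)\<close> tends to the square of \<alpha>, both denominators
    in \<kappa> and \<mu> are eventually positive.\<close>
  have "0 < \<alpha> * \<alpha>"
    using \<open>\<alpha> \<noteq> 0\<close> not_real_square_gt_zero[of \<alpha>] by blast
  then have "\<forall>\<^sub>F x in at 0. 0 < 1 + k1 x" and "\<forall>\<^sub>F x in at 0. 0 < J (c x)"
    using order_tendstoD(1)[OF k1', of 0] order_tendstoD(1)[OF J, of 0] by simp_all
  then have "\<forall>\<^sub>F x in at 0.
      Phi_of P\<^sub>Y Q\<^sub>Y F\<^sub>Y x - Phi_of P\<^sub>X Q\<^sub>X F\<^sub>X (u x) = \<kappa> x * f_of Q\<^sub>Y F\<^sub>Y x \<and>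
      f_of Q\<^sub>X F\<^sub>X (u x) = \<mu> x * f_of Q\<^sub>Y F\<^sub>Y x"
    using in_U in_UY in_UX in_UX' near_c[OF conj] near_c[OF near_U] FXu FYx k1(2) k2(2) k3(2)
  proof eventually_elim
    case (elim x)
    define f where "f = Q\<^sub>Y (c x)"
    have uv: "\<phi> (c x) = (u x, v x)" by (simp add: u_def v_def)
    have vert: "snd (c x) + P\<^sub>Y (c x) = 0" using elim(10) by (simp add: c_def)
    have "vf P\<^sub>Y Q\<^sub>Y (c x) = (0, f)"
      using vert by (simp add: vf_def f_def)
    then have "D (0, f) \<phi> (c x) = vf P\<^sub>X Q\<^sub>X (u x, v x)"
      using eventually_nhds_x_imp_x[OF elim(7)] by (simp add: uv)
    then have "f *\<^sub>R b (c x) = (v x + P\<^sub>X (u x, v x), Q\<^sub>X (u x, v x))"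
      using D_Pair[OF diff_U(1)[OF elim(3)], of 0 f] by (simp add: vf_def b_def)
    then have fb: "f * fst (b (c x)) = v x + P\<^sub>X (u x, v x)" "f * snd (b (c x)) = Q\<^sub>X (u x, v x)"
      by (auto simp: prod_eq_iff)
    \<comment> \<open>Subtracting the equation of the curve at \<open>u x\<close> shows that the
      first component of \<open>X\<close> measures the vertical gap to that curve.\<close>
    have "v x + P\<^sub>X (u x, v x) = (1 + k1 x) * (v x - F\<^sub>X (u x))"
      using elim(9,11) by (simp add: algebra_simps)
    with fb(1) have vF: "v x - F\<^sub>X (u x) = f * (fst (b (c x)) / (1 + k1 x))"
      using elim(1) by (simp add: field_simps)
    have "J (c x) * (divergence P\<^sub>X Q\<^sub>X (\<phi> (c x)) - divergence P\<^sub>Y Q\<^sub>Y (c x)) = f * K (c x)"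
      using conjugates_divergence[OF elim(7,8) diff_U(2)[OF elim(3)] diff_UY[OF elim(4)]
          diff_UX[OF elim(5)] vert]
      unfolding J_def K_def a_def b_def m_def l_def f_def .
    then have "divergence P\<^sub>X Q\<^sub>X (\<phi> (c x)) - divergence P\<^sub>Y Q\<^sub>Y (c x) = f * (K (c x) / J (c x))"
      using elim(2) by (simp add: field_simps)
    moreover have "Phi_of P\<^sub>Y Q\<^sub>Y F\<^sub>Y x = divergence P\<^sub>Y Q\<^sub>Y (c x)"
      unfolding c_def by (rule Phi_of_eq) (use diff_UY[OF elim(4)] in \<open>simp_all add: c_def\<close>)
    moreover have "Phi_of P\<^sub>X Q\<^sub>X F\<^sub>X (u x) = divergence P\<^sub>X Q\<^sub>X (u x, F\<^sub>X (u x))"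
      by (rule Phi_of_eq) (rule diff_UX[OF elim(6)])+
    ultimately have "Phi_of P\<^sub>Y Q\<^sub>Y F\<^sub>Y x - Phi_of P\<^sub>X Q\<^sub>X F\<^sub>X (u x) = \<kappa> x * f"
      using elim(13) unfolding \<kappa>_def vF uv by (simp add: algebra_simps)
    moreover have "Q\<^sub>X (u x, F\<^sub>X (u x)) = \<mu> x * f"
      using elim(12) fb(2) unfolding \<mu>_def vF by (simp add: algebra_simps)
    ultimately show ?case
      by (simp add: f_of_def f_def c_def)
  qed
  ultimately show thesis
    using that[OF \<open>\<alpha> \<noteq> 0\<close> u'] eventually_conj_iff by blast
qed

section \<open>Invariance of the monodromy conditions\<close>

text \<open>The quotient splits into \<open>h (u x) / u x ^ k\<close> and
  \<open>(u x / x) ^ k\<close>. As \<alpha> is nonzero, \<open>u\<close> eventually avoids 0, so the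
  punctured limit of \<open>h\<close> can be composed with it.\<close>

lemma tendsto_substitute_divide_power:
  fixes h u :: "real \<Rightarrow> real"
  assumes h: "((\<lambda>w. h w / w ^ k) \<longlongrightarrow> L) (at 0)"
    and u: "((\<lambda>x. u x / x) \<longlongrightarrow> \<alpha>) (at 0)" and "\<alpha> \<noteq> 0"
  shows "((\<lambda>x. h (u x) / x ^ k) \<longlongrightarrow> L * \<alpha> ^ k) (at 0)"
proof -
  have ne: "\<forall>\<^sub>F x in at 0. u x \<noteq> 0"
    using tendsto_imp_eventually_ne[OF u \<open>\<alpha> \<noteq> 0\<close>] by eventually_elim auto
  have x: "\<forall>\<^sub>F x::real in at 0. x \<noteq> 0"
    by (rule eventually_neq_at_within)
  have "((\<lambda>x. u x / x * x) \<longlongrightarrow> \<alpha> * 0) (at 0)"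
    by (rule tendsto_mult[OF u tendsto_ident_at])
  moreover have "\<forall>\<^sub>F x in at 0. u x / x * x = u x"
    using x by eventually_elim simp
  ultimately have "(u \<longlongrightarrow> \<alpha> * 0) (at 0)"
    by (rule Lim_transform_eventually)
  then have "(u \<longlongrightarrow> 0) (at 0)"
    by simp
  then have "filterlim u (at 0) (at 0)"
    using ne by (rule filterlim_atI)
  from tendsto_mult[OF filterlim_compose[OF h this] tendsto_power[OF u]]
  have "((\<lambda>x. h (u x) / u x ^ k * (u x / x) ^ k) \<longlongrightarrow> L * \<alpha> ^ k) (at 0)" .
  moreover have "\<forall>\<^sub>F x in at 0. h (u x) / u x ^ k * (u x / x) ^ k = h (u x) / x ^ k"
    using ne by eventually_elim (simp add: power_divide)
  ultimately show ?thesis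
    by (rule Lim_transform_eventually)
qed

lemma leading_term_unique:
  assumes "leading_term f a k" "leading_term f b k"
  shows "a = b"
  using assms tendsto_unique[OF at_neq_bot] unfolding leading_term_iff by blast

text \<open>The leading coefficient of \<open>f\<close> is unique, so the known \<open>a\<close>
  replaces the quantified one and only \<open>b\<close> remains to be transported.\<close>

lemma condition_ii_iff:
  assumes "leading_term f a (2 * n - 1)"
  shows "condition_ii n f \<Phi> \<longleftrightarrow>
    (\<exists>b. b \<noteq> 0 \<and> ((\<lambda>x. \<Phi> x / x ^ (n - 1)) \<longlongrightarrow> b) (at 0) \<and> b\<^sup>2 + 4 * a * real n < 0)"
proof
  assume "condition_ii n f \<Phi>"
  then obtain a' b where "leading_term f a' (2 * n - 1)" "leading_term \<Phi> b (n - 1)"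
    "b\<^sup>2 + 4 * a' * real n < 0"
    unfolding condition_ii_def by blast
  moreover from leading_term_unique[OF this(1) assms] have "a' = a" .
  ultimately show "\<exists>b. b \<noteq> 0 \<and> ((\<lambda>x. \<Phi> x / x ^ (n - 1)) \<longlongrightarrow> b) (at 0) \<and> b\<^sup>2 + 4 * a * real n < 0"
    unfolding leading_term_iff by blast
next
  assume "\<exists>b. b \<noteq> 0 \<and> ((\<lambda>x. \<Phi> x / x ^ (n - 1)) \<longlongrightarrow> b) (at 0) \<and> b\<^sup>2 + 4 * a * real n < 0"
  then show "condition_ii n f \<Phi>"
    using assms unfolding condition_ii_def leading_term_iff by blast
qed

theorem proposition17:
  fixes n r :: nat
    and P\<^sub>X Q\<^sub>X P\<^sub>Y Q\<^sub>Y :: "real \<times> real \<Rightarrow> real"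
    and F\<^sub>X F\<^sub>Y :: "real \<Rightarrow> real"
    and \<phi> :: "real \<times> real \<Rightarrow> real \<times> real"
  assumes "n \<ge> 1" and "r \<ge> 3" and "2 * n - 1 < r"
    and "nilpotent_system r P\<^sub>X Q\<^sub>X" and "nilpotent_system r P\<^sub>Y Q\<^sub>Y"
    and "isolated_singular_point (vf P\<^sub>X Q\<^sub>X)" and "isolated_singular_point (vf P\<^sub>Y Q\<^sub>Y)"
    and "monodromic (vf P\<^sub>X Q\<^sub>X)" and "monodromic (vf P\<^sub>Y Q\<^sub>Y)"
    and "implicit_solution r P\<^sub>X F\<^sub>X" and "implicit_solution r P\<^sub>Y F\<^sub>Y"
    and "andreev_number n (f_of Q\<^sub>X F\<^sub>X)" and "andreev_number n (f_of Q\<^sub>Y F\<^sub>Y)"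
    and "local_diffeo r \<phi>" and "conjugates \<phi> (vf P\<^sub>Y Q\<^sub>Y) (vf P\<^sub>X Q\<^sub>X)"
  shows "(condition_i r n (Phi_of P\<^sub>X Q\<^sub>X F\<^sub>X) \<longleftrightarrow> condition_i r n (Phi_of P\<^sub>Y Q\<^sub>Y F\<^sub>Y)) \<and>
         (condition_ii n (f_of Q\<^sub>X F\<^sub>X) (Phi_of P\<^sub>X Q\<^sub>X F\<^sub>X) \<longleftrightarrow>
          condition_ii n (f_of Q\<^sub>Y F\<^sub>Y) (Phi_of P\<^sub>Y Q\<^sub>Y F\<^sub>Y))"
proof -
  \<comment> \<open>Writing \<open>2 * n - 1\<close> as \<open>Suc (2 * m)\<close> removes truncated
    subtraction from the exponents.\<close>
  define m where "m = n - 1"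
  have N: "2 * n - 1 = Suc (2 * m)"
    using assms(1) by (simp add: m_def)
  let ?f\<^sub>X = "f_of Q\<^sub>X F\<^sub>X" and ?f\<^sub>Y = "f_of Q\<^sub>Y F\<^sub>Y"
  let ?\<Phi>\<^sub>X = "Phi_of P\<^sub>X Q\<^sub>X F\<^sub>X" and ?\<Phi>\<^sub>Y = "Phi_of P\<^sub>Y Q\<^sub>Y F\<^sub>Y"
  obtain a\<^sub>X a\<^sub>Y where lead: "leading_term ?f\<^sub>X a\<^sub>X (2 * n - 1)" "leading_term ?f\<^sub>Y a\<^sub>Y (2 * n - 1)"
    using assms(12,13) unfolding andreev_number_def by blast
  then have f: "((\<lambda>x. ?f\<^sub>X x / x ^ Suc (2 * m)) \<longlongrightarrow> a\<^sub>X) (at 0)"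
    "((\<lambda>x. ?f\<^sub>Y x / x ^ Suc (2 * m)) \<longlongrightarrow> a\<^sub>Y) (at 0)"
    unfolding leading_term_iff N by simp_all
  have "r \<ge> 2" "r \<ge> 1" "n < r"
    using assms(1-3) by simp_all
  obtain \<alpha> c u \<kappa> \<mu> where \<alpha>: "\<alpha> \<noteq> 0" and u: "((\<lambda>x. u x / x) \<longlongrightarrow> \<alpha>) (at 0)"
    and \<kappa>: "(\<kappa> \<longlongrightarrow> c) (at 0)" and \<mu>: "(\<mu> \<longlongrightarrow> \<alpha>) (at 0)"
    and \<Phi>u: "\<forall>\<^sub>F x in at 0. ?\<Phi>\<^sub>Y x - ?\<Phi>\<^sub>X (u x) = \<kappa> x * ?f\<^sub>Y x"
    and fu: "\<forall>\<^sub>F x in at 0. ?f\<^sub>X (u x) = \<mu> x * ?f\<^sub>Y x"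
    by (rule conjugates_asymptotics[OF \<open>r \<ge> 2\<close> assms(4,10,5,11,14,15)])

  \<comment> \<open>The limit of \<open>f_of Q\<^sub>X F\<^sub>X (u x) / x ^ Suc (2 * m)\<close> is
    computed twice, through \<mu> and by substitution; equating the values relates
    \<open>a\<^sub>Y\<close> to \<open>a\<^sub>X\<close>.\<close>
  have "((\<lambda>x. \<mu> x * (?f\<^sub>Y x / x ^ Suc (2 * m))) \<longlongrightarrow> \<alpha> * a\<^sub>Y) (at 0)"
    by (rule tendsto_mult[OF \<mu> f(2)])
  moreover have "\<forall>\<^sub>F x in at 0. \<mu> x * (?f\<^sub>Y x / x ^ Suc (2 * m)) = ?f\<^sub>X (u x) / x ^ Suc (2 * m)"
    using fu by eventually_elim simp
  ultimately have "((\<lambda>x. ?f\<^sub>X (u x) / x ^ Suc (2 * m)) \<longlongrightarrow> \<alpha> * a\<^sub>Y) (at 0)"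
    by (rule Lim_transform_eventually)
  then have "\<alpha> * a\<^sub>Y = a\<^sub>X * \<alpha> ^ Suc (2 * m)"
    by (rule tendsto_unique[OF at_neq_bot _ tendsto_substitute_divide_power[OF f(1) u \<alpha>]])
  then have a: "a\<^sub>Y = a\<^sub>X * (\<alpha> ^ m)\<^sup>2"
    using \<alpha> by (simp add: power_mult mult.commute[of 2] flip: power_mult)

  \<comment> \<open>For \<open>k\<close> at most \<open>m\<close>, hence below
    \<open>Suc (2 * m)\<close>, the error term \<kappa> times \<open>f\<close> disappears after
    division by \<open>x ^ k\<close>.\<close>
  have \<Phi>: "((\<lambda>x. ?\<Phi>\<^sub>Y x / x ^ k) \<longlongrightarrow> L * \<alpha> ^ k) (at 0)"
    if L: "((\<lambda>x. ?\<Phi>\<^sub>X x / x ^ k) \<longlongrightarrow> L) (at 0)" and "k \<le> m" for k L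
  proof -
    have "k < Suc (2 * m)"
      using that(2) by simp
    from tendsto_add[OF tendsto_substitute_divide_power[OF L u \<alpha>]
        tendsto_mult[OF \<kappa> tendsto_divide_power_less[OF f(2) this]]]
    have "((\<lambda>x. ?\<Phi>\<^sub>X (u x) / x ^ k + \<kappa> x * (?f\<^sub>Y x / x ^ k)) \<longlongrightarrow> L * \<alpha> ^ k) (at 0)"
      by simp
    moreover have "\<forall>\<^sub>F x in at 0. ?\<Phi>\<^sub>X (u x) / x ^ k + \<kappa> x * (?f\<^sub>Y x / x ^ k) = ?\<Phi>\<^sub>Y x / x ^ k"
      using \<Phi>u by eventually_elim (simp add: field_simps flip: add_divide_distrib)
    ultimately show ?thesis
      by (rule Lim_transform_eventually)
  qed

  obtain V\<^sub>X where VX: "open V\<^sub>X" "0 \<in> V\<^sub>X" "higher_differentiable_on V\<^sub>X ?\<Phi>\<^sub>X (r - 1)"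
    by (rule Phi_of_higher_differentiable[OF assms(4,10) \<open>r \<ge> 1\<close>])
  obtain V\<^sub>Y where VY: "open V\<^sub>Y" "0 \<in> V\<^sub>Y" "higher_differentiable_on V\<^sub>Y ?\<Phi>\<^sub>Y (r - 1)"
    by (rule Phi_of_higher_differentiable[OF assms(5,11) \<open>r \<ge> 1\<close>])
  have "higher_differentiable_on V\<^sub>X ?\<Phi>\<^sub>X m"
    using higher_differentiable_on_le[OF VX(3)] \<open>n < r\<close> by (simp add: m_def)
  note expand = tendsto_or_leading_term[OF VX(1,2) this]

  have iff: "((\<lambda>x. ?\<Phi>\<^sub>X x / x ^ m) \<longlongrightarrow> b) (at 0) \<longleftrightarrow>
      ((\<lambda>x. ?\<Phi>\<^sub>Y x / x ^ m) \<longlongrightarrow> b * \<alpha> ^ m) (at 0)" for b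
  proof
    \<comment> \<open>The converse avoids inverting \<phi>. Either \<open>?\<Phi>\<^sub>X\<close>
      has some limit, which is identified after transport, or its leading term of order
      \<open>k < m\<close> would pass to \<open>?\<Phi>\<^sub>Y\<close> and contradict
      \<open>Y\<close>.\<close>
    assume Y: "((\<lambda>x. ?\<Phi>\<^sub>Y x / x ^ m) \<longlongrightarrow> b * \<alpha> ^ m) (at 0)"
    from expand show "((\<lambda>x. ?\<Phi>\<^sub>X x / x ^ m) \<longlongrightarrow> b) (at 0)"
    proof (elim disjE exE conjE)
      fix b' assume X: "((\<lambda>x. ?\<Phi>\<^sub>X x / x ^ m) \<longlongrightarrow> b') (at 0)"
      have "b' * \<alpha> ^ m = b * \<alpha> ^ m"
        by (rule tendsto_unique[OF at_neq_bot \<Phi>[OF X order_refl] Y])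
      with \<alpha> X show ?thesis by simp
    next
      fix b' k assume "k < m" "leading_term ?\<Phi>\<^sub>X b' k"
      then have "b' \<noteq> 0" and X: "((\<lambda>x. ?\<Phi>\<^sub>X x / x ^ k) \<longlongrightarrow> b') (at 0)"
        by (simp_all add: leading_term_iff)
      have "b' * \<alpha> ^ k = 0"
        by (rule tendsto_unique[OF at_neq_bot \<Phi>[OF X less_imp_le[OF \<open>k < m\<close>]]
              tendsto_divide_power_less[OF Y \<open>k < m\<close>]])
      with \<alpha> \<open>b' \<noteq> 0\<close> show ?thesis by simp
    qed
  qed (rule \<Phi>[OF _ order_refl])

  have "condition_i r n ?\<Phi>\<^sub>X \<longleftrightarrow> condition_i r n ?\<Phi>\<^sub>Y"
    using iff[of 0] unfolding condition_i_iff[OF VX \<open>n < r\<close>] condition_i_iff[OF VY \<open>n < r\<close>] m_def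
    by simp
  moreover have "condition_ii n ?f\<^sub>X ?\<Phi>\<^sub>X \<longleftrightarrow> condition_ii n ?f\<^sub>Y ?\<Phi>\<^sub>Y"
  proof -
    \<comment> \<open>Both summands scale by the same positive factor, the square of
      \<open>\<alpha> ^ m\<close>.\<close>
    have sign: "(b * \<alpha> ^ m)\<^sup>2 + 4 * a\<^sub>Y * real n < 0 \<longleftrightarrow> b\<^sup>2 + 4 * a\<^sub>X * real n < 0" for b
    proof -
      have "(b * \<alpha> ^ m)\<^sup>2 + 4 * a\<^sub>Y * real n = (b\<^sup>2 + 4 * a\<^sub>X * real n) * (\<alpha> ^ m)\<^sup>2"
        unfolding a by (simp add: algebra_simps)
      then show ?thesis
        using \<alpha> by (simp add: mult_less_0_iff)
    qed
    \<comment> \<open>Multiplication by the nonzero \<open>\<alpha> ^ m\<close> is a bijection, so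
      the coefficient of \<open>?\<Phi>\<^sub>Y\<close> can be quantified in the form
      \<open>b * \<alpha> ^ m\<close> required by \<open>iff\<close> and
      \<open>sign\<close>.\<close>
    have scale: "(\<exists>b. R b) \<longleftrightarrow> (\<exists>b. R (b * \<alpha> ^ m))" for R
    proof
      assume "\<exists>b. R b"
      then obtain b where "R (b / \<alpha> ^ m * \<alpha> ^ m)" using \<alpha> by auto
      then show "\<exists>b. R (b * \<alpha> ^ m)" by blast
    qed blast
    show ?thesis
      unfolding condition_ii_iff[OF lead(1)] condition_ii_iff[OF lead(2)] m_def[symmetric]
        scale[of "\<lambda>b. b \<noteq> 0 \<and> ((\<lambda>x. ?\<Phi>\<^sub>Y x / x ^ m) \<longlongrightarrow> b) (at 0) \<and> b\<^sup>2 + 4 * a\<^sub>Y * real n < 0"]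
        sign iff using \<alpha> by simp
  qed
  ultimately show ?thesis ..
qed

end
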